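(* Let $G$ be a subgroup of $\mathrm{GL}(d,\mathbb{R})$ and let $V$ be a finite-dimensional vector subspace of $X_d$. Suppose that there is $z_0\in\mathbb{R}^d$ such that $\Lambda_{G,z_0}$ has nonempty interior in $\mathbb{R}^d$, that $\tau_h(V)\subseteq V$ for all $h\in\mathbb{R}^d$, and that $O_P(V)\subseteq V$ for all $P\in G$. Then every element of $V$ is an ordinary polynomial in $d$ real variables.
   Context: $X_d$ denotes either $C(\mathbb{R}^d)$ (real-valued continuous functions) or $\mathcal{D}(\mathbb{R}^d)'$ (real-valued Schwartz distributions). For $g\in C(\mathbb{R}^d)$, $h\in\mathbb{R}^d$, $P\in\mathrm{GL}(d,\mathbb{R})$: $\tau_hg(x)=g(x+h)$ and $O_Pg(x)=g(Px)$. For $f\in\mathcal{D}(\mathbb{R}^d)'$ and a test function $\phi$: $\tau_h(f)\{\phi\}=f\{\phi(\cdot-h)\}$ and $O_P(f)\{\phi\}=\frac{1}{|\det P|}f\{\phi(P^{-1}\cdot)\}$. For a subgroup $G\subseteq\mathrm{GL}(d,\mathbb{R})$ and $z_0\in\mathbb{R}^d$, $\Lambda_{G,z_0}=\{Pz_0-Qz_0: P,Q\in G\}$. A distribution is an ordinary polynomial if it coincides, as a distribution, with an element of $\mathbb{R}[x_1,\dots,x_d]$ (for continuous functions this means equality everywhere). *)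

theory Defs
  imports "HOL-Analysis.Analysis"
begin

definition subgroup_GL :: "(real^'n^'n) set \<Rightarrow> bool" where
  "subgroup_GL G \<longleftrightarrow> G \<noteq> {} \<and> (\<forall>P\<in>G. invertible P) \<and>
     (\<forall>P\<in>G. \<forall>Q\<in>G. P ** Q \<in> G) \<and> (\<forall>P\<in>G. matrix_inv P \<in> G)"

definition Lambda_set :: "(real^'n^'n) set \<Rightarrow> real^'n \<Rightarrow> (real^'n) set" where
  "Lambda_set G z0 = {P *v z0 - Q *v z0 | P Q. P \<in> G \<and> Q \<in> G}"

definition fin_dim_subspace :: "('a \<Rightarrow> real) set \<Rightarrow> bool" where
  "fin_dim_subspace V \<longleftrightarrow> (\<exists>B. finite B \<and>
     V = {(\<lambda>x. \<Sum>b\<in>B. c b * b x) | c. True})"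

definition is_polynomial :: "(real^'n \<Rightarrow> real) \<Rightarrow> bool" where
  "is_polynomial p \<longleftrightarrow> (\<exists>(A :: ('n \<Rightarrow> nat) set) c. finite A \<and>
     p = (\<lambda>x. \<Sum>\<alpha>\<in>A. c \<alpha> * (\<Prod>i\<in>UNIV. (x $ i) ^ (\<alpha> i))))"

fun pderivs :: "'n list \<Rightarrow> (real^'n \<Rightarrow> real) \<Rightarrow> real^'n \<Rightarrow> real" where
  "pderivs [] g = g"
| "pderivs (i # is) g = (\<lambda>x. deriv (\<lambda>t. pderivs is g (x + t *\<^sub>R axis i 1)) 0)"

definition smooth_fun :: "(real^'n \<Rightarrow> real) \<Rightarrow> bool" where
  "smooth_fun g \<longleftrightarrow> (\<forall>is. continuous_on UNIV (pderivs is g) \<and>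
     (\<forall>i x. (\<lambda>t. pderivs is g (x + t *\<^sub>R axis i 1)) differentiable (at 0)))"

definition test_fun :: "(real^'n \<Rightarrow> real) \<Rightarrow> bool" where
  "test_fun \<phi> \<longleftrightarrow> smooth_fun \<phi> \<and> compact (closure {x. \<phi> x \<noteq> 0})"

text \<open>Schwartz distributions: linear functionals on test functions, continuous
  (seminorm characterization). Convention: a distribution is normalized to be 0 on
  non-test functions, so that equality as distributions is literal equality.\<close>
definition distribution :: "((real^'n \<Rightarrow> real) \<Rightarrow> real) \<Rightarrow> bool" where
  "distribution f \<longleftrightarrow>
     (\<forall>\<phi>. \<not> test_fun \<phi> \<longrightarrow> f \<phi> = 0) \<and>
     (\<forall>\<phi> \<psi> a b. test_fun \<phi> \<longrightarrow> test_fun \<psi> \<longrightarrow>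
        f (\<lambda>x. a * \<phi> x + b * \<psi> x) = a * f \<phi> + b * f \<psi>) \<and>
     (\<forall>K. compact K \<longrightarrow> (\<exists>C N. \<forall>\<phi>. test_fun \<phi> \<and> closure {x. \<phi> x \<noteq> 0} \<subseteq> K \<longrightarrow>
        \<bar>f \<phi>\<bar> \<le> C * (\<Sum>is\<in>{is :: 'n list. length is \<le> N}.
                          (SUP x. \<bar>pderivs is \<phi> x\<bar>))))"

definition tau_C :: "real^'n \<Rightarrow> (real^'n \<Rightarrow> real) \<Rightarrow> (real^'n \<Rightarrow> real)" where
  "tau_C h g = (\<lambda>x. g (x + h))"

definition O_C :: "real^'n^'n \<Rightarrow> (real^'n \<Rightarrow> real) \<Rightarrow> (real^'n \<Rightarrow> real)" where
  "O_C P g = (\<lambda>x. g (P *v x))"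

definition tau_D :: "real^'n \<Rightarrow> ((real^'n \<Rightarrow> real) \<Rightarrow> real) \<Rightarrow> ((real^'n \<Rightarrow> real) \<Rightarrow> real)" where
  "tau_D h f = (\<lambda>\<phi>. if test_fun \<phi> then f (\<lambda>x. \<phi> (x - h)) else 0)"

definition O_D :: "real^'n^'n \<Rightarrow> ((real^'n \<Rightarrow> real) \<Rightarrow> real) \<Rightarrow> ((real^'n \<Rightarrow> real) \<Rightarrow> real)" where
  "O_D P f = (\<lambda>\<phi>. if test_fun \<phi> then f (\<lambda>x. \<phi> (matrix_inv P *v x)) / \<bar>det P\<bar> else 0)"

definition poly_distribution :: "((real^'n \<Rightarrow> real) \<Rightarrow> real) \<Rightarrow> bool" where
  "poly_distribution f \<longleftrightarrow> (\<exists>p. is_polynomial p \<and>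
     (\<forall>\<phi>. test_fun \<phi> \<longrightarrow> f \<phi> = integral UNIV (\<lambda>x. p x * \<phi> x)))"

end

theory Submission
  imports Defs
begin

text \<open>
  Write \<open>\<tau>\<^sub>h\<close> for the translations on \<open>V\<close>. For \<open>P, Q \<in> G\<close> the operator \<open>\<tau>\<^bsub>nPz\<^sub>0 - nQz\<^sub>0\<^esub>\<close> is
  \<open>O\<^sub>P\<^sup>-\<^sup>1 \<tau>\<^bsub>nz\<^sub>0\<^esub> X \<tau>\<^bsub>-nz\<^sub>0\<^esub> O\<^sub>Q\<close> with \<open>X = O\<^sub>P O\<^sub>Q\<^sup>-\<^sup>1\<close>. Since the maps
  \<open>X \<mapsto> \<tau>\<^bsub>nz\<^sub>0\<^esub> X \<tau>\<^bsub>-nz\<^sub>0\<^esub>\<close> live in a finite-dimensional space, there are coefficients \<open>q\<^sub>n\<close>, not all zero, with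
  \<open>\<Sum>q\<^sub>n \<tau>\<^bsub>nh\<^esub> = 0\<close> on \<open>V\<close> for all \<open>h \<in> \<Lambda>\<close>. As \<open>h\<close> ranges over an open set, all but one of the terms
  can be eliminated by differencing, which gives Frechet's equation \<open>\<Delta>\<^sub>v\<^sup>N f = 0\<close> for every \<open>v\<close>. Its continuous
  solutions are polynomials by Newton interpolation in each coordinate, and its distributional
  solutions are continuous functions because convolution with a suitable test function reproduces them.
\<close>

section \<open>Finite differences and polynomials\<close>

text \<open>For a single \<open>h\<close> the translation by \<open>h\<close> on \<open>V\<close>
  has an annihilating polynomial by Cayley-Hamilton, but its coefficients vary with
  \<open>h\<close>, while cancelling a term needs the same coefficients at \<open>h\<close> and at a
  nearby point. The conjugation supplies this: \<open>n\<close> enters only through the operators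
  around X, and \<open>h\<close> only through X, P and Q, so one relation valid for every X serves
  all \<open>h\<close>. An interior point of \<Lambda> lets \<open>h\<close> move in every
  direction. N is the number of cancelled terms; it depends neither on \<open>v\<close> nor on the
  element of \<open>V\<close>, and this uniformity makes Newton interpolation stop at a fixed
  degree. Both choices of X_d are treated at once: \<open>V\<close> consists of real functions on a
  type \<open>'a\<close>, of points or of test functions, and the orbit function
  \<open>y \<mapsto> T y g a\<close> is an ordinary function on R^d in either case. Continuity
  enters only afterwards.\<close>

definition fdiff :: "'a::ab_group_add \<Rightarrow> ('a \<Rightarrow> real) \<Rightarrow> 'a \<Rightarrow> real" where
  "fdiff v F = (\<lambda>x. F (x + v) - F x)"

lemma fdiff_commute: "fdiff v (fdiff w F) = fdiff w (fdiff v F)"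
  by (simp add: fdiff_def algebra_simps)

lemma fdiff_funpow_commute: "(fdiff v ^^ n) (fdiff w F) = fdiff w ((fdiff v ^^ n) F)"
  by (induction n) (simp_all add: fdiff_commute)

lemma fdiff_funpow_funpow_commute:
  "(fdiff v ^^ n) ((fdiff w ^^ m) F) = (fdiff w ^^ m) ((fdiff v ^^ n) F)"
  by (induction m) (simp_all add: fdiff_funpow_commute)

lemma fdiff_zero [simp]: "fdiff v (\<lambda>_. 0) = (\<lambda>_. 0)"
  by (simp add: fdiff_def)

lemma fdiff_funpow_zero [simp]: "(fdiff v ^^ n) (\<lambda>_. 0) = (\<lambda>_. 0)"
  by (induction n) simp_all

text \<open>Serves for restriction to a line as well as for pulling back along a linear
  projection.\<close>

lemma fdiff_funpow_comp:
  fixes \<pi> :: "'a::ab_group_add \<Rightarrow> 'b::ab_group_add"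
  assumes "\<And>x. \<pi> (x + v) = \<pi> x + w"
  shows "(fdiff v ^^ n) (\<lambda>x. F (\<pi> x)) = (\<lambda>x. (fdiff w ^^ n) F (\<pi> x))"
  by (induction n) (simp_all add: fdiff_def assms)

text \<open>Differences commute, so the factors \<open>fdiff v\<close> can be exchanged one at a
  time: what a single \<open>fdiff v\<close> kills is \<open>v\<close>-periodic, hence also periodic
  under every natural multiple of \<open>v\<close>.\<close>

lemma fdiff_funpow_multiple:
  fixes v :: "'a::real_vector"
  assumes "(fdiff v ^^ N) F = (\<lambda>_. 0)"
  shows "(fdiff (real k *\<^sub>R v) ^^ N) F = (\<lambda>_. 0)"
  using assms
proof (induction N arbitrary: F)
  case (Suc N)
  define H where "H = (fdiff v ^^ N) F"
  have "fdiff v H = (\<lambda>_. 0)"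
    using Suc.prems by (simp add: H_def)
  then have step: "H (x + v) = H x" for x
    by (simp add: fdiff_def fun_eq_iff)
  have period: "H (x + real k *\<^sub>R v) = H x" for x
  proof (induction k)
    case (Suc k)
    have "H (x + real (Suc k) *\<^sub>R v) = H ((x + real k *\<^sub>R v) + v)"
      by (simp add: algebra_simps)
    then show ?case using Suc step by metis
  qed simp
  have "(fdiff v ^^ N) (fdiff (real k *\<^sub>R v) F) = fdiff (real k *\<^sub>R v) H"
    by (simp add: fdiff_funpow_commute H_def)
  also have "\<dots> = (\<lambda>_. 0)"
    by (simp add: fdiff_def period)
  finally show ?case
    using Suc.IH by (simp add: funpow_swap1)
qed simp

text \<open>The weights are the signed binomial coefficients. What matters later is that they depend
  only on \<open>N\<close> and that \<open>w 0 \<noteq> 0\<close> allows solving for the value at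
  \<open>x\<close>.\<close>

lemma fdiff_funpow_weights:
  "\<exists>w::nat \<Rightarrow> real. w 0 \<noteq> 0 \<and>
    (\<forall>(F :: 'a::real_vector \<Rightarrow> real) v x. (fdiff v ^^ N) F x = (\<Sum>k\<le>N. w k * F (x + real k *\<^sub>R v)))"
proof (induction N)
  case 0
  show ?case by (rule exI[of _ "\<lambda>_. 1"]) simp
next
  case (Suc N)
  then obtain w :: "nat \<Rightarrow> real" where w0: "w 0 \<noteq> 0" and
    w: "\<And>(F :: 'a \<Rightarrow> real) v x. (fdiff v ^^ N) F x = (\<Sum>k\<le>N. w k * F (x + real k *\<^sub>R v))"
    by blast
  \<comment> \<open>Pascal's rule with signs, \<open>w\<close> being extended by zero outside
    \<open>0..N\<close>.\<close>
  define w' where "w' k = (if k = 0 then 0 else w (k - 1)) - (if k \<le> N then w k else 0)" for k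
  have "(fdiff v ^^ Suc N) F x = (\<Sum>k\<le>Suc N. w' k * F (x + real k *\<^sub>R v))"
    for F :: "'a \<Rightarrow> real" and v x
  proof -
    have "(\<Sum>k\<le>Suc N. w' k * F (x + real k *\<^sub>R v)) =
      (\<Sum>k\<le>Suc N. (if k = 0 then 0 else w (k - 1)) * F (x + real k *\<^sub>R v)) -
      (\<Sum>k\<le>Suc N. (if k \<le> N then w k else 0) * F (x + real k *\<^sub>R v))"
      by (simp only: w'_def left_diff_distrib sum_subtractf)
    moreover have "(\<Sum>k\<le>Suc N. (if k = 0 then 0 else w (k - 1)) * F (x + real k *\<^sub>R v)) =
       (\<Sum>k\<le>N. w k * F (x + v + real k *\<^sub>R v))"
      by (subst sum.atMost_Suc_shift) (simp add: algebra_simps)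
    ultimately show ?thesis
      by (simp add: fdiff_def w)
  qed
  then show ?case using w0 by (intro exI[of _ w']) (auto simp: w'_def)
qed

text \<open>The shift by \<open>h\<close> is the identity plus \<open>fdiff h\<close>, and its
  \<open>m\<close>-th power is expanded by the binomial theorem.\<close>

lemma newton_forward:
  fixes u :: "'a::real_vector \<Rightarrow> real"
  shows "u (x + real m *\<^sub>R h) = (\<Sum>k\<le>m. real (m choose k) * (fdiff h ^^ k) u x)"
proof (induction m arbitrary: u)
  case (Suc m)
  have "u (x + real (Suc m) *\<^sub>R h) = u (x + real m *\<^sub>R h) + fdiff h u (x + real m *\<^sub>R h)"
    by (simp add: fdiff_def algebra_simps)
  also have "\<dots> = (\<Sum>k\<le>m. real (m choose k) * (fdiff h ^^ k) u x)
      + (\<Sum>k\<le>m. real (m choose k) * (fdiff h ^^ Suc k) u x)"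
    by (simp only: Suc funpow_Suc_right o_apply)
  also have "(\<Sum>k\<le>m. real (m choose k) * (fdiff h ^^ k) u x) =
      (\<Sum>k\<le>Suc m. real (m choose k) * (fdiff h ^^ k) u x)"
    by simp
  also have "\<dots> = u x + (\<Sum>k\<le>m. real (m choose Suc k) * (fdiff h ^^ Suc k) u x)"
    by (subst sum.atMost_Suc_shift) simp
  also have "\<dots> + (\<Sum>k\<le>m. real (m choose k) * (fdiff h ^^ Suc k) u x) =
     u x + (\<Sum>k\<le>m. real (Suc m choose Suc k) * (fdiff h ^^ Suc k) u x)"
    by (simp add: sum.distrib[symmetric] algebra_simps)
  also have "\<dots> = (\<Sum>k\<le>Suc m. real (Suc m choose k) * (fdiff h ^^ k) u x)"
    by (subst sum.atMost_Suc_shift) simp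
  finally show ?case .
qed simp

text \<open>The number of remaining terms does not depend on \<open>m\<close>, so with
  \<open>gchoose\<close> the right side is a polynomial in \<open>m\<close>, ready for a real
  argument.\<close>

lemma newton_forward_vanishing:
  fixes u :: "'a::real_vector \<Rightarrow> real"
  assumes "(fdiff h ^^ N) u = (\<lambda>_. 0)"
  shows "u (x + real m *\<^sub>R h) = (\<Sum>k<N. (real m gchoose k) * (fdiff h ^^ k) u x)"
proof -
  have high: "(fdiff h ^^ k) u = (\<lambda>_. 0)" if "N \<le> k" for k
  proof -
    have "k = (k - N) + N" using that by simp
    then have "(fdiff h ^^ k) u = (fdiff h ^^ (k - N)) ((fdiff h ^^ N) u)"
      by (metis funpow_add o_apply)
    then show ?thesis by (simp add: assms)
  qed
  have "u (x + real m *\<^sub>R h) = (\<Sum>k\<le>m. real (m choose k) * (fdiff h ^^ k) u x)"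
    by (rule newton_forward)
  \<comment> \<open>The range up to \<open>m + N\<close> contains both others; binomials vanish
    beyond \<open>m\<close>, differences from \<open>N\<close> on.\<close>
  also have "\<dots> = (\<Sum>k\<le>m+N. real (m choose k) * (fdiff h ^^ k) u x)"
    by (rule sum.mono_neutral_left) auto
  also have "\<dots> = (\<Sum>k<N. real (m choose k) * (fdiff h ^^ k) u x)"
    by (rule sum.mono_neutral_right) (auto simp: high)
  finally show ?thesis by (simp add: binomial_gbinomial)
qed

section \<open>Newton interpolation in one real variable\<close>

definition poly_fun :: "(real \<Rightarrow> real) \<Rightarrow> bool" where
  "poly_fun f \<longleftrightarrow> (\<exists>p. \<forall>t. f t = poly p t)"

text \<open>The affine argument covers both a refined step (\<open>c = q\<close>) and a moved base
  point (\<open>d = -z\<close>).\<close>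

lemma poly_fun_gchoose_sum: "poly_fun (\<lambda>t. \<Sum>k<N. ((c * t + d) gchoose k) * a k)"
proof -
  define p where "p = (\<Sum>k<N. smult (a k / fact k) (\<Prod>i<k. [:d - real i, c:]))"
  have "(\<Sum>k<N. ((c * t + d) gchoose k) * a k) = poly p t" for t
    by (simp add: p_def poly_sum poly_prod gbinomial_prod_rev atLeast0LessThan algebra_simps)
  then show ?thesis by (auto simp: poly_fun_def)
qed

lemma poly_fun_eqI:
  assumes "poly_fun f" "poly_fun g" "infinite {t. f t = g t}"
  shows "f = g"
proof -
  obtain p q where p: "\<And>t. f t = poly p t" and q: "\<And>t. g t = poly q t"
    using assms(1,2) by (auto simp: poly_fun_def)
  have "infinite {t. poly (p - q) t = 0}"
    using assms(3) by (simp add: p q)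
  then have "p - q = 0" using poly_roots_finite by blast
  then show ?thesis by (auto simp: p q)
qed

lemma poly_fun_eq_on_nats:
  assumes "poly_fun f" "poly_fun g" "\<And>m. f (real m) = g (real m)"
  shows "f = g"
proof -
  have "range real \<subseteq> {t. f t = g t}" using assms(3) by auto
  moreover have "infinite (range real)"
    by (simp add: finite_image_iff inj_on_def)
  ultimately show ?thesis
    using assms(1,2) poly_fun_eqI infinite_super by blast
qed

lemma poly_fun_continuous: "poly_fun f \<Longrightarrow> continuous_on UNIV f"
proof -
  assume "poly_fun f"
  then obtain p where "f = poly p" by (auto simp: poly_fun_def)
  then show ?thesis by (simp add: continuous_on_poly)
qed

text \<open>The Newton polynomials of step \<open>1 / q\<close> all agree with \<open>u\<close> on the integers, hence
  coincide; so \<open>u\<close> is this one polynomial on the rationals.\<close>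
lemma newton_interpolation_nonneg:
  fixes u :: "real \<Rightarrow> real"
  assumes cont: "continuous_on UNIV u"
    and van: "\<And>h. (fdiff h ^^ N) u = (\<lambda>_. 0)"
    and "t \<ge> 0"
  shows "u (x + t) = (\<Sum>k<N. (t gchoose k) * (fdiff 1 ^^ k) u x)"
proof -
  \<comment> \<open>\<open>P q\<close> is the Newton series with step \<open>1 / q\<close>, as a
    function of the offset \<open>s\<close> from \<open>x\<close>; the \<open>+ 0\<close> is there
    to match \<open>poly_fun_gchoose_sum\<close>.\<close>
  define P where "P q s = (\<Sum>k<N. ((q * s + 0) gchoose k) * (fdiff (1 / q) ^^ k) u x)" for q s :: real
  have pf: "poly_fun (P q)" for q
    unfolding P_def[abs_def] by (rule poly_fun_gchoose_sum)
  have grid: "u (x + real m / q) = P q (real m / q)" if "q > 0" for m q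
    using newton_forward_vanishing[OF van[of "1/q"], of x m] that by (simp add: P_def)
  have same: "P (real q) = P 1" if "q > 0" for q :: nat
  proof (rule poly_fun_eq_on_nats[OF pf pf])
    fix m
    \<comment> \<open>The offset \<open>m\<close> is reached from \<open>x\<close> in
      \<open>m * q\<close> steps of length \<open>1 / q\<close>.\<close>
    show "P (real q) (real m) = P 1 (real m)"
      using grid[of "real q" "m * q"] grid[of 1 m] that by simp
  qed
  have rat: "u (x + real m / real q) = P 1 (real m / real q)" if "q > 0" for m q :: nat
    using grid[of "real q" m] same[OF that] that by simp
  define s where "s n = real (nat \<lfloor>t * real (Suc n)\<rfloor>) / real (Suc n)" for n
  have "s \<longlonglongrightarrow> t"
  proof (rule tendsto_sandwich)
    show "\<forall>\<^sub>F n in sequentially. t - 1 / real (Suc n) \<le> s n"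
    proof (rule always_eventually, rule allI)
      fix n
      have "t * real (Suc n) - 1 \<le> real (nat \<lfloor>t * real (Suc n)\<rfloor>)"
        by linarith
      then have "(t * real (Suc n) - 1) / real (Suc n) \<le> s n"
        unfolding s_def by (intro divide_right_mono) auto
      then show "t - 1 / real (Suc n) \<le> s n"
        by (simp add: diff_divide_distrib)
    qed
    show "\<forall>\<^sub>F n in sequentially. s n \<le> t"
    proof (rule always_eventually, rule allI)
      fix n
      have "t * real (Suc n) \<ge> 0" using \<open>t \<ge> 0\<close> by simp
      then have "real (nat \<lfloor>t * real (Suc n)\<rfloor>) \<le> t * real (Suc n)"
        by linarith
      then show "s n \<le> t"
        unfolding s_def by (simp add: divide_le_eq)
    qed
    show "(\<lambda>n. t - 1 / real (Suc n)) \<longlonglongrightarrow> t"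
      using tendsto_diff[OF tendsto_const LIMSEQ_inverse_real_of_nat, of t]
      by (simp add: inverse_eq_divide)
  qed simp
  then have lims: "(\<lambda>n. u (x + s n)) \<longlonglongrightarrow> u (x + t)" "(\<lambda>n. P 1 (s n)) \<longlonglongrightarrow> P 1 t"
    using continuous_on_tendsto_compose[OF cont, of "\<lambda>n. x + s n" "x + t" sequentially]
      continuous_on_tendsto_compose[OF poly_fun_continuous[OF pf], of s t sequentially]
    by (auto intro: tendsto_add[OF tendsto_const])
  moreover have "u (x + s n) = P 1 (s n)" for n
    unfolding s_def by (rule rat) simp
  ultimately have "u (x + t) = P 1 t"
    using LIMSEQ_unique by simp
  then show ?thesis by (simp add: P_def)
qed

text \<open>The one-sided expansion only reaches points to the right of its base, so the base is
  first put at \<open>-\<bar>t\<bar>\<close>. The expansions from that base and from 0 agree on the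
  naturals, hence everywhere.\<close>

lemma newton_interpolation:
  fixes u :: "real \<Rightarrow> real"
  assumes cont: "continuous_on UNIV u"
    and van: "\<And>h. (fdiff h ^^ N) u = (\<lambda>_. 0)"
  shows "u t = (\<Sum>k<N. (t gchoose k) * (fdiff 1 ^^ k) u 0)"
proof -
  define s where "s = \<bar>t\<bar>"
  define P where "P z t = (\<Sum>k<N. ((1 * t + (- z)) gchoose k) * (fdiff 1 ^^ k) u z)" for z t :: real
  have eq: "u t = P z t" if "t \<ge> z" for z t
    using newton_interpolation_nonneg[OF cont van, of "t - z" z] that by (simp add: P_def)
  have pf: "poly_fun (P z)" for z
    unfolding P_def[abs_def] by (rule poly_fun_gchoose_sum)
  have "P (-s) = P 0"
  proof (rule poly_fun_eq_on_nats[OF pf pf])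
    show "P (-s) (real m) = P 0 (real m)" for m
      using eq[of "-s" "real m"] eq[of 0 "real m"] by (simp add: s_def)
  qed
  then have "u t = P 0 t" using eq[of "-s" t] by (simp add: s_def)
  then show ?thesis by (simp add: P_def)
qed

section \<open>The algebra of polynomials in several variables\<close>

lemma is_polynomialI:
  fixes \<alpha> :: "'j \<Rightarrow> 'n::finite \<Rightarrow> nat"
  assumes "finite J" and "\<And>x. p x = (\<Sum>j\<in>J. c j * (\<Prod>i\<in>UNIV. (x $ i) ^ \<alpha> j i))"
  shows "is_polynomial p"
  unfolding is_polynomial_def
proof (intro exI conjI)
  show "finite (\<alpha> ` J)" using assms(1) by simp
  \<comment> \<open>Different indices may carry the same exponent, as happens in products, so
    coefficients are added over the fibres of \<open>\<alpha>\<close>.\<close>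
  show "p = (\<lambda>x. \<Sum>a\<in>\<alpha> ` J. (\<Sum>j\<in>{j\<in>J. \<alpha> j = a}. c j) * (\<Prod>i\<in>UNIV. (x $ i) ^ a i))"
  proof
    fix x
    have "p x = (\<Sum>a\<in>\<alpha> ` J. \<Sum>j\<in>{j\<in>J. \<alpha> j = a}. c j * (\<Prod>i\<in>UNIV. (x $ i) ^ \<alpha> j i))"
      unfolding assms(2) by (rule sum.image_gen[OF assms(1)])
    then show "p x = (\<Sum>a\<in>\<alpha> ` J. (\<Sum>j\<in>{j\<in>J. \<alpha> j = a}. c j) * (\<Prod>i\<in>UNIV. (x $ i) ^ a i))"
      by (simp add: sum_distrib_right)
  qed
qed

lemma is_polynomial_const: "is_polynomial (\<lambda>x. c)"
  by (rule is_polynomialI[of "{()}" _ "\<lambda>_. c" "\<lambda>_ _. 0"]) auto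

lemma is_polynomial_coord: "is_polynomial (\<lambda>x::real^'n. x $ i)"
proof (rule is_polynomialI[of "{()}" _ "\<lambda>_. 1" "\<lambda>_ j. if j = i then 1 else 0"])
  fix x :: "real^'n"
  have "(\<Prod>j\<in>UNIV. (x $ j) ^ (if j = i then 1 else 0)) = (\<Prod>j\<in>UNIV. if j = i then x $ j else 1)"
    by (rule prod.cong) auto
  then show "x $ i = (\<Sum>j\<in>{()}. 1 * (\<Prod>j\<in>UNIV. (x $ j) ^ (if j = i then 1 else 0)))"
    by simp
qed auto

lemma is_polynomial_add:
  assumes "is_polynomial p" "is_polynomial q"
  shows "is_polynomial (\<lambda>x. p x + q x)"
proof -
  obtain A c where A: "finite A" "p = (\<lambda>x. \<Sum>\<alpha>\<in>A. c \<alpha> * (\<Prod>i\<in>UNIV. (x $ i) ^ (\<alpha> i)))"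
    using assms(1) unfolding is_polynomial_def by blast
  obtain B d where B: "finite B" "q = (\<lambda>x. \<Sum>\<alpha>\<in>B. d \<alpha> * (\<Prod>i\<in>UNIV. (x $ i) ^ (\<alpha> i)))"
    using assms(2) unfolding is_polynomial_def by blast
  show ?thesis
  proof (rule is_polynomialI[of "A <+> B" _ "case_sum c d" "case_sum id id"])
    show "p x + q x = (\<Sum>j\<in>A <+> B. case_sum c d j * (\<Prod>i\<in>UNIV. x $ i ^ case_sum id id j i))" for x
      using A B by (simp add: sum.Plus)
  qed (use A B in auto)
qed

lemma is_polynomial_mult:
  assumes "is_polynomial p" "is_polynomial q"
  shows "is_polynomial (\<lambda>x. p x * q x)"
proof -
  obtain A c where A: "finite A" "p = (\<lambda>x. \<Sum>\<alpha>\<in>A. c \<alpha> * (\<Prod>i\<in>UNIV. (x $ i) ^ (\<alpha> i)))"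
    using assms(1) unfolding is_polynomial_def by blast
  obtain B d where B: "finite B" "q = (\<lambda>x. \<Sum>\<alpha>\<in>B. d \<alpha> * (\<Prod>i\<in>UNIV. (x $ i) ^ (\<alpha> i)))"
    using assms(2) unfolding is_polynomial_def by blast
  show ?thesis
  proof (rule is_polynomialI[of "A \<times> B" _ "\<lambda>(a, b). c a * d b" "\<lambda>(a, b) i. a i + b i"])
    show "p x * q x = (\<Sum>j\<in>A \<times> B. (case j of (a, b) \<Rightarrow> c a * d b) *
        (\<Prod>i\<in>UNIV. x $ i ^ (case j of (a, b) \<Rightarrow> \<lambda>i. a i + b i) i))" for x
      unfolding A(2) B(2) sum_product sum.cartesian_product
      by (rule sum.cong) (auto simp: power_add prod.distrib)
  qed (use A B in auto)
qed

lemma is_polynomial_sum: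
  "(\<And>k. k \<in> K \<Longrightarrow> is_polynomial (p k)) \<Longrightarrow> is_polynomial (\<lambda>x. \<Sum>k\<in>K. p k x)"
  by (induction K rule: infinite_finite_induct) (auto intro: is_polynomial_const is_polynomial_add)

lemma is_polynomial_prod:
  "(\<And>k. k \<in> K \<Longrightarrow> is_polynomial (p k)) \<Longrightarrow> is_polynomial (\<lambda>x. \<Prod>k\<in>K. p k x)"
  by (induction K rule: infinite_finite_induct) (auto intro: is_polynomial_const is_polynomial_mult)

lemma is_polynomial_gchoose: "is_polynomial (\<lambda>x. (x $ i) gchoose k)"
proof -
  have "is_polynomial (\<lambda>x::real^'a. (\<Prod>j<k. (x $ i + (- real j))) * (1 / fact k))"
    by (intro is_polynomial_mult is_polynomial_prod is_polynomial_add is_polynomial_const is_polynomial_coord)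
  then show ?thesis
    by (simp add: gbinomial_prod_rev atLeast0LessThan)
qed

section \<open>Frechet's equation for continuous functions\<close>

lemma continuous_on_fdiff_funpow:
  fixes F :: "'a::real_normed_vector \<Rightarrow> real"
  assumes "continuous_on UNIV F"
  shows "continuous_on UNIV ((fdiff v ^^ n) F)"
proof (induction n)
  case (Suc n)
  have "continuous_on UNIV (\<lambda>x. (fdiff v ^^ n) F (x + v))"
    by (rule continuous_on_compose2[OF Suc]) (auto intro!: continuous_intros)
  then show ?case using Suc by (auto simp: fdiff_def[of v "(fdiff v ^^ n) F"] intro!: continuous_intros)
qed (use assms in simp)

text \<open>\<open>S\<close> is a set of coordinates that \<open>F\<close> depends on, and the
  induction is over it: Newton expansion in coordinate \<open>i\<close> has the binomials of
  \<open>x $ i\<close> as factors, with coefficients that no longer involve \<open>x $ i\<close> and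
  inherit the equation.\<close>

lemma frechet_polynomial_aux:
  fixes F :: "real^'n \<Rightarrow> real"
  assumes "finite S" "continuous_on UNIV F"
    and "\<And>v. (fdiff v ^^ N) F = (\<lambda>_. 0)"
    and "\<And>x y. (\<And>i. i \<in> S \<Longrightarrow> x $ i = y $ i) \<Longrightarrow> F x = F y"
  shows "is_polynomial F"
  using assms
proof (induction S arbitrary: F rule: finite_induct)
  case empty
  have "F = (\<lambda>x. F 0)" by (intro ext empty.prems(3)) simp
  then show ?case by (rule ssubst[where P = is_polynomial]) (rule is_polynomial_const)
next
  case (insert i S)
  define e :: "real^'n" where "e = axis i 1"
  define \<pi> where "\<pi> x = x - (x $ i) *\<^sub>R e" for x
  define G where "G k x = (fdiff e ^^ k) F (\<pi> x)" for k x
  have pi_add: "\<pi> (x + v) = \<pi> x + \<pi> v" for x v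
    by (simp add: \<pi>_def algebra_simps)
  have pi_cont: "continuous_on UNIV \<pi>"
    unfolding \<pi>_def[abs_def] by (intro continuous_intros)
  have expand: "F x = (\<Sum>k<N. ((x $ i) gchoose k) * G k x)" for x
  proof -
    define u where "u t = F (\<pi> x + t *\<^sub>R e)" for t
    have pow: "(fdiff h ^^ n) u = (\<lambda>t. (fdiff (h *\<^sub>R e) ^^ n) F (\<pi> x + t *\<^sub>R e))" for h n
      unfolding u_def[abs_def] by (rule fdiff_funpow_comp) (simp add: algebra_simps)
    have "continuous_on UNIV u"
      unfolding u_def[abs_def]
      by (rule continuous_on_compose2[OF insert.prems(1)]) (auto intro!: continuous_intros)
    from newton_interpolation[OF this, of N "x $ i"]
    show ?thesis
      by (simp add: pow insert.prems(2) G_def) (simp add: u_def \<pi>_def)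
  qed
  have "is_polynomial (G k)" for k
  proof (rule insert.IH)
    show "continuous_on UNIV (G k)"
      unfolding G_def[abs_def]
      by (rule continuous_on_compose2[OF continuous_on_fdiff_funpow[OF insert.prems(1)] pi_cont]) simp
    \<comment> \<open>\<open>\<pi>\<close> is additive and differences commute, so differencing
      \<open>G k\<close> by \<open>v\<close> amounts to differencing \<open>F\<close> by
      \<open>\<pi> v\<close>.\<close>
    show "(fdiff v ^^ N) (G k) = (\<lambda>_. 0)" for v
      unfolding G_def[abs_def]
      by (subst fdiff_funpow_comp[where w = "\<pi> v"])
        (simp_all add: pi_add fdiff_funpow_funpow_commute[where v = "\<pi> v"] insert.prems(2))
    show "G k x = G k y" if "\<And>j. j \<in> S \<Longrightarrow> x $ j = y $ j" for x y
    proof -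
      have ei: "e $ i = 1" by (simp add: e_def)
      \<comment> \<open>Differencing along \<open>e\<close> keeps the dependence on
        \<open>insert i S\<close>; composing with \<open>\<pi>\<close> sets coordinate
        \<open>i\<close> to 0, which leaves \<open>S\<close>.\<close>
      have "(fdiff e ^^ k) F z = (fdiff e ^^ k) F z'" if "\<And>j. j \<in> insert i S \<Longrightarrow> z $ j = z' $ j" for z z'
        using that
      proof (induction k arbitrary: z z')
        case 0
        from insert.prems(3)[OF this] show ?case by simp
      next
        case (Suc k)
        have "(fdiff e ^^ k) F (z + e) = (fdiff e ^^ k) F (z' + e)" "(fdiff e ^^ k) F z = (fdiff e ^^ k) F z'"
          by (rule Suc.IH; use Suc.prems in auto)+
        then show ?case by (simp add: fdiff_def[of e "(fdiff e ^^ k) F"])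
      qed
      moreover have "\<pi> x $ j = \<pi> y $ j" if "j \<in> insert i S" for j
        using that \<open>\<And>j. j \<in> S \<Longrightarrow> x $ j = y $ j\<close> ei insert.hyps(2)
        by (auto simp: \<pi>_def e_def axis_def)
      ultimately show ?thesis unfolding G_def by blast
    qed
  qed
  then have "is_polynomial (\<lambda>x. \<Sum>k<N. ((x $ i) gchoose k) * G k x)"
    by (intro is_polynomial_sum is_polynomial_mult is_polynomial_gchoose)
  moreover have "F = (\<lambda>x. \<Sum>k<N. ((x $ i) gchoose k) * G k x)"
    using expand by (rule ext)
  ultimately show ?case by simp
qed

theorem frechet_polynomial:
  fixes F :: "real^'n \<Rightarrow> real"
  assumes "continuous_on UNIV F" "\<And>v. (fdiff v ^^ N) F = (\<lambda>_. 0)"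
  shows "is_polynomial F"
proof (rule frechet_polynomial_aux[of UNIV F N])
  show "F x = F y" if "\<And>i. i \<in> UNIV \<Longrightarrow> x $ i = y $ i" for x y
  proof -
    have "x = y" using that by (simp add: vec_eq_iff)
    then show ?thesis by simp
  qed
qed (use assms in auto)

section \<open>Elimination and annihilating relations\<close>

text \<open>Replacing \<open>(y, h)\<close> by \<open>(y - j u, h + u)\<close> fixes \<open>y + j h\<close>, so subtracting the two
  relations removes the term with index \<open>j\<close> and differences the others.\<close>
lemma fdiff_eliminate:
  fixes f :: "nat \<Rightarrow> 'a::real_normed_vector \<Rightarrow> real"
  assumes "finite J" "m \<notin> J" "r > real (card J) * norm v"
    and "\<And>y h. h \<in> ball h0 r \<Longrightarrow> f m (y + real m *\<^sub>R h) + (\<Sum>n\<in>J. f n (y + real n *\<^sub>R h)) = 0"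
  shows "(fdiff v ^^ card J) (f m) = (\<lambda>_. 0)"
  using assms
proof (induction J arbitrary: f r rule: finite_induct)
  case empty
  have "f m x = 0" for x
    using empty.prems(3)[of h0 "x - real m *\<^sub>R h0"] empty.prems(2) by simp
  then show ?case by auto
next
  case (insert j J)
  define d where "d = real m - real j"
  have "m \<noteq> j" using insert.prems(1) by auto
  then have d: "\<bar>d\<bar> \<ge> 1" by (auto simp: d_def)
  \<comment> \<open>Dividing by \<open>m - j\<close> makes the step applied to \<open>f m\<close>
    equal to \<open>v\<close>. As \<bar>m - j\<bar> \<ge> 1, each elimination moves \<open>h\<close>
    by at most \<open>norm v\<close>, which is what the radius hypothesis pays for.\<close>
  define u where "u = (1 / d) *\<^sub>R v"
  have "norm u = norm v / \<bar>d\<bar>" by (simp add: u_def)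
  also have "\<dots> \<le> norm v" using d by (simp add: divide_le_eq mult_le_cancel_left1)
  finally have norm_u: "norm u \<le> norm v" .
  have du: "d *\<^sub>R u = v" using d by (auto simp: u_def)
  define f' where "f' n = fdiff ((real n - real j) *\<^sub>R u) (f n)" for n
  have "(fdiff v ^^ card J) (f' m) = (\<lambda>_. 0)"
  proof (rule insert.IH)
    show "m \<notin> J" using insert.prems(1) by auto
    show "real (card J) * norm v < r - norm v"
      using insert.prems(2) insert.hyps by (simp add: algebra_simps)
    fix y h assume h: "h \<in> ball h0 (r - norm v)"
    have "norm (h0 - (h + u)) \<le> norm (h0 - h) + norm u"
      using norm_triangle_ineq4[of "h0 - h" u] by (simp add: algebra_simps)
    with h norm_u have hu: "h + u \<in> ball h0 r" by (simp add: dist_norm)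
    have "norm v \<ge> 0" by simp
    with h have h': "h \<in> ball h0 r" by (auto simp: dist_norm simp del: norm_ge_zero)
    have shift: "y - real j *\<^sub>R u + real n *\<^sub>R (h + u) = y + real n *\<^sub>R h + (real n - real j) *\<^sub>R u" for n
      by (simp add: algebra_simps)
    have "f m (y + real m *\<^sub>R h) + (\<Sum>n\<in>insert j J. f n (y + real n *\<^sub>R h)) = 0"
      by (rule insert.prems(3)[OF h'])
    moreover have "f m (y - real j *\<^sub>R u + real m *\<^sub>R (h + u)) +
        (\<Sum>n\<in>insert j J. f n (y - real j *\<^sub>R u + real n *\<^sub>R (h + u))) = 0"
      by (rule insert.prems(3)[OF hu])
    ultimately show "f' m (y + real m *\<^sub>R h) + (\<Sum>n\<in>J. f' n (y + real n *\<^sub>R h)) = 0"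
      using insert.hyps unfolding shift by (simp add: f'_def fdiff_def sum_subtractf)
  qed
  moreover have "f' m = fdiff v (f m)"
    by (simp add: f'_def du[unfolded d_def])
  ultimately show ?case
    using insert.hyps by (simp add: funpow_swap1)
qed

text \<open>Every \<open>v\<close> is a natural multiple of a short vector.\<close>

lemma fdiff_funpow_eq_0_of_small:
  fixes F :: "'a::real_normed_vector \<Rightarrow> real"
  assumes "\<delta> > 0" and "\<And>v. norm v < \<delta> \<Longrightarrow> (fdiff v ^^ N) F = (\<lambda>_. 0)"
  shows "(fdiff v ^^ N) F = (\<lambda>_. 0)"
proof -
  obtain k where k: "norm v / \<delta> < real k" using reals_Archimedean2 by blast
  have "norm v / \<delta> \<ge> 0" using assms(1) by simp
  with k have "k > 0" by (cases k) auto
  have "norm ((1 / real k) *\<^sub>R v) < \<delta>"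
    using k \<open>k > 0\<close> assms(1) by (simp add: field_simps)
  from fdiff_funpow_multiple[OF assms(2)[OF this], of k]
  show ?thesis using \<open>k > 0\<close> by simp
qed

section \<open>Linear relations in finite-dimensional spaces of functions\<close>

lemma nontrivial_relation:
  fixes v :: "'i \<Rightarrow> 's \<Rightarrow> real"
  assumes "finite S" "finite I" "card I > card S"
  shows "\<exists>q. (\<exists>i\<in>I. q i \<noteq> 0) \<and> (\<forall>s\<in>S. (\<Sum>i\<in>I. q i * v i s) = 0)"
  using assms
proof (induction S arbitrary: v I rule: finite_induct)
  case empty
  then have "I \<noteq> {}" by auto
  then show ?case by (intro exI[of _ "\<lambda>_. 1"]) auto
next
  case (insert s S)
  show ?case
  proof (cases "\<forall>i\<in>I. v i s = 0")
    case True
    have "card S < card I" using insert by simp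
    from insert.IH[OF insert.prems(1) this, of v] True show ?thesis by auto
  next
    case False
    then obtain j where j: "j \<in> I" "v j s \<noteq> 0" by blast
    \<comment> \<open>Gaussian elimination: multiples of the pivot \<open>v j\<close> clear
      coordinate \<open>s\<close>, and the coefficient of the pivot in \<open>q'\<close> makes up
      for them.\<close>
    define v' where "v' i t = v i t - v i s / v j s * v j t" for i t
    have fin: "finite (I - {j})" using insert.prems(1) by simp
    have "card S < card (I - {j})" using insert j by simp
    from insert.IH[OF fin this, of v'] obtain q i where
      q: "i \<in> I - {j}" "q i \<noteq> 0" "\<And>t. t \<in> S \<Longrightarrow> (\<Sum>i\<in>I - {j}. q i * v' i t) = 0"
      by blast
    define q' where "q' = q(j := - (\<Sum>i\<in>I - {j}. q i * v i s / v j s))"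
    have sum_q': "(\<Sum>i\<in>I. q' i * v i t) = (\<Sum>i\<in>I - {j}. q i * v' i t)" for t
    proof -
      have "(\<Sum>i\<in>I. q' i * v i t) = q' j * v j t + (\<Sum>i\<in>I - {j}. q' i * v i t)"
        using insert.prems(1) j(1) by (rule sum.remove)
      also have "(\<Sum>i\<in>I - {j}. q' i * v i t) = (\<Sum>i\<in>I - {j}. q i * v i t)"
        by (rule sum.cong) (auto simp: q'_def)
      also have "q' j * v j t = - (\<Sum>i\<in>I - {j}. q i * (v i s / v j s * v j t))"
        by (simp add: q'_def sum_distrib_right sum_distrib_left algebra_simps)
      finally show ?thesis
        by (simp add: v'_def right_diff_distrib sum_subtractf)
    qed
    have "v' i s = 0" for i using j by (simp add: v'_def)
    then have "\<forall>t\<in>insert s S. (\<Sum>i\<in>I. q' i * v i t) = 0"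
      using q(3) by (auto simp: sum_q')
    moreover have "q' i \<noteq> 0" "i \<in> I" using q by (auto simp: q'_def)
    ultimately show ?thesis by blast
  qed
qed

text \<open>Linearity on all functions rather than on \<open>V\<close> alone: each of the four
  operators evaluates its argument at a transformed point or test function, so it is linear
  globally, and the rules below carry no membership conditions.\<close>

definition linear_op :: "(('a \<Rightarrow> real) \<Rightarrow> 'b \<Rightarrow> real) \<Rightarrow> bool" where
  "linear_op L \<longleftrightarrow> (\<forall>f g. L (\<lambda>x. f x + g x) = (\<lambda>x. L f x + L g x)) \<and>
     (\<forall>c f. L (\<lambda>x. c * f x) = (\<lambda>x. c * L f x))"

lemma linear_op_sum:
  assumes "linear_op L"
  shows "L (\<lambda>x. \<Sum>i\<in>I. c i * f i x) = (\<lambda>x. \<Sum>i\<in>I. c i * L (f i) x)"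
proof -
  have add: "L (\<lambda>x. f x + g x) = (\<lambda>x. L f x + L g x)"
    and scale: "L (\<lambda>x. c * f x) = (\<lambda>x. c * L f x)" for f g c
    using assms by (auto simp: linear_op_def)
  have "L (\<lambda>x. 0) = (\<lambda>x. 0)" using scale[of 0] by simp
  then show ?thesis
    by (induction I rule: infinite_finite_induct) (simp_all add: add scale)
qed

lemma linear_op_comp: "linear_op L \<Longrightarrow> linear_op M \<Longrightarrow> linear_op (\<lambda>f. L (M f))"
  by (simp add: linear_op_def)

text \<open>The relation lives in the finite-dimensional space of coefficient arrays indexed by
  \<open>B \<times> B \<times> B \<times> B\<close>, so it can be chosen independently of \<open>X\<close>.\<close>
lemma uniform_sandwich_relation:
  fixes V :: "('a \<Rightarrow> real) set" and L R :: "nat \<Rightarrow> ('a \<Rightarrow> real) \<Rightarrow> 'a \<Rightarrow> real"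
  assumes fin: "fin_dim_subspace V"
    and L: "\<And>n. linear_op (L n)" "\<And>n g. g \<in> V \<Longrightarrow> L n g \<in> V"
    and R: "\<And>n. linear_op (R n)" "\<And>n g. g \<in> V \<Longrightarrow> R n g \<in> V"
  shows "\<exists>I q. finite I \<and> (\<exists>n\<in>I. q n \<noteq> 0) \<and>
    (\<forall>X g. linear_op X \<longrightarrow> (\<forall>g\<in>V. X g \<in> V) \<longrightarrow> g \<in> V \<longrightarrow>
       (\<lambda>x. \<Sum>n\<in>I. q n * L n (X (R n g)) x) = (\<lambda>_. 0))"
proof -
  obtain B where B: "finite B" and V: "V = {(\<lambda>x. \<Sum>b\<in>B. c b * b x) | c. True}"
    using fin by (auto simp: fin_dim_subspace_def)
  have BV: "b \<in> V" if "b \<in> B" for b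
  proof -
    have "b = (\<lambda>x. \<Sum>b'\<in>B. (if b' = b then 1 else 0) * b' x)"
      using B that by (simp add: if_distrib[of "\<lambda>c. c * _"] cong: if_cong)
    then show ?thesis unfolding V mem_Collect_eq by (intro exI[of _ "\<lambda>b'. if b' = b then 1 else 0"]) simp
  qed
  have coords: "\<exists>c. g = (\<lambda>x. \<Sum>b\<in>B. c b * b x)" if "g \<in> V" for g
    using that unfolding V by blast
  have "\<forall>n b. \<exists>c. b \<in> B \<longrightarrow> L n b = (\<lambda>x. \<Sum>b'\<in>B. c b' * b' x)"
    using coords L(2) BV by blast
  then obtain l where l: "\<And>n b. b \<in> B \<Longrightarrow> L n b = (\<lambda>x. \<Sum>b'\<in>B. l n b b' * b' x)"
    by metis
  have "\<forall>n b. \<exists>c. b \<in> B \<longrightarrow> R n b = (\<lambda>x. \<Sum>b'\<in>B. c b' * b' x)"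
    using coords R(2) BV by blast
  then obtain m where m: "\<And>n b. b \<in> B \<Longrightarrow> R n b = (\<lambda>x. \<Sum>b'\<in>B. m n b b' * b' x)"
    by metis
  define S where "S = B \<times> B \<times> B \<times> B"
  \<comment> \<open>Entries of \<open>R n\<close> times entries of \<open>L n\<close>, with respect
    to the spanning set \<open>B\<close>. In \<open>L n (X (R n g))\<close> they are combined
    linearly with coefficients that come from \<open>X\<close> and \<open>g\<close> and are free of
    \<open>n\<close>, so a relation between these arrays survives for any \<open>X\<close>.\<close>
  define v where "v n s = (case s of (b1, b2, b3, b4) \<Rightarrow> m n b1 b2 * l n b3 b4)" for n s
  have "finite S" using B by (simp add: S_def)
  \<comment> \<open>\<open>{..card S}\<close> has one index more than the arrays have entries. The
    arrays are counted by \<open>n\<close>, so coincidences among them do no harm.\<close>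
  then obtain q where q: "\<exists>n\<in>{..card S}. q n \<noteq> 0" "\<forall>s\<in>S. (\<Sum>n\<in>{..card S}. q n * v n s) = 0"
    using nontrivial_relation[of S "{..card S}" v] by auto
  define I where "I = {..card S}"
  have rel: "(\<Sum>n\<in>I. q n * (m n b1 b2 * l n b3 b4)) = 0"
    if "b1 \<in> B" "b2 \<in> B" "b3 \<in> B" "b4 \<in> B" for b1 b2 b3 b4
    using bspec[OF q(2), of "(b1, b2, b3, b4)"] that by (simp add: S_def v_def I_def)
  have "(\<lambda>x. \<Sum>n\<in>I. q n * L n (X (R n g)) x) = (\<lambda>_. 0)"
    if X: "linear_op X" "\<forall>g\<in>V. X g \<in> V" and g: "g \<in> V" for X g
  proof -
    have "\<forall>b. \<exists>c. b \<in> B \<longrightarrow> X b = (\<lambda>x. \<Sum>b'\<in>B. c b' * b' x)"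
      using coords X(2) BV by blast
    then obtain \<xi> where \<xi>: "\<And>b. b \<in> B \<Longrightarrow> X b = (\<lambda>x. \<Sum>b'\<in>B. \<xi> b b' * b' x)"
      by metis
    obtain c where c: "g = (\<lambda>x. \<Sum>b\<in>B. c b * b x)" using coords[OF g] by blast
    have LX: "L n (X b2) x = (\<Sum>b3\<in>B. \<Sum>b4\<in>B. \<xi> b2 b3 * (l n b3 b4 * b4 x))" if "b2 \<in> B" for n b2 x
      using that by (simp add: \<xi> linear_op_sum[OF L(1)] l sum_distrib_left)
    have LXR: "L n (X (R n b1)) x =
        (\<Sum>b2\<in>B. \<Sum>b3\<in>B. \<Sum>b4\<in>B. \<xi> b2 b3 * b4 x * (m n b1 b2 * l n b3 b4))" if "b1 \<in> B" for n b1 x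
      using that by (simp add: m linear_op_sum[OF linear_op_comp[OF L(1) X(1)]] LX sum_distrib_left)
        (simp add: mult_ac)
    have "(\<Sum>n\<in>I. q n * L n (X (R n b1)) x) = 0" if b1: "b1 \<in> B" for b1 x
    proof -
      have "(\<Sum>n\<in>I. q n * L n (X (R n b1)) x) =
        (\<Sum>n\<in>I. \<Sum>b2\<in>B. \<Sum>b3\<in>B. \<Sum>b4\<in>B. \<xi> b2 b3 * b4 x * (q n * (m n b1 b2 * l n b3 b4)))"
        by (simp add: LXR[OF b1] sum_distrib_left mult_ac)
      also have "\<dots> = (\<Sum>b2\<in>B. \<Sum>b3\<in>B. \<Sum>b4\<in>B. \<Sum>n\<in>I. \<xi> b2 b3 * b4 x * (q n * (m n b1 b2 * l n b3 b4)))"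
        by (simp only: sum.swap[where A = I and B = B])
      also have "\<dots> = 0"
        by (simp only: sum_distrib_left[symmetric])
          (use rel[OF b1] in \<open>simp cong: sum.cong\<close>)
      finally show ?thesis .
    qed
    note zero = this
    have lin: "linear_op (\<lambda>g. L n (X (R n g)))" for n
      using linear_op_comp[OF linear_op_comp[OF L(1) X(1)] R(1)] .
    have "(\<Sum>n\<in>I. q n * L n (X (R n g)) x) = 0" for x
    proof -
      have "(\<Sum>n\<in>I. q n * L n (X (R n g)) x) = (\<Sum>n\<in>I. \<Sum>b\<in>B. c b * (q n * L n (X (R n b)) x))"
        unfolding c linear_op_sum[OF lin] by (simp add: sum_distrib_left mult_ac)
      also have "\<dots> = (\<Sum>b\<in>B. c b * (\<Sum>n\<in>I. q n * L n (X (R n b)) x))"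
        by (subst sum.swap) (simp add: sum_distrib_left)
      also have "\<dots> = 0" by (simp add: zero)
      finally show ?thesis .
    qed
    then show ?thesis by blast
  qed
  moreover have "finite I" "\<exists>n\<in>I. q n \<noteq> 0" using q(1) by (auto simp: I_def)
  ultimately show ?thesis by blast
qed

lemma subgroup_GL_inverse:
  assumes "subgroup_GL G" "P \<in> G"
  shows "matrix_inv P \<in> G" "P ** matrix_inv P = mat 1" "matrix_inv P ** P = mat 1"
    "matrix_inv (matrix_inv P) = P"
proof -
  show "matrix_inv P \<in> G" using assms by (auto simp: subgroup_GL_def)
  have "invertible P" using assms by (auto simp: subgroup_GL_def)
  then have inv: "P ** matrix_inv P = mat 1 \<and> matrix_inv P ** P = mat 1"
    unfolding invertible_def matrix_inv_def by (rule someI_ex)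
  then have "invertible (matrix_inv P)"
    unfolding invertible_def by blast
  then have inv': "matrix_inv P ** matrix_inv (matrix_inv P) = mat 1 \<and>
      matrix_inv (matrix_inv P) ** matrix_inv P = mat 1"
    unfolding invertible_def matrix_inv_def[of "matrix_inv P"] by (rule someI_ex)
  have "P ** (matrix_inv P ** matrix_inv (matrix_inv P)) = matrix_inv (matrix_inv P)"
    using inv by (simp add: matrix_mul_assoc)
  then show "matrix_inv (matrix_inv P) = P" using inv' by simp
  show "P ** matrix_inv P = mat 1" "matrix_inv P ** P = mat 1" using inv by auto
qed

text \<open>The conclusion says that \<open>T v\<close> is unipotent on \<open>V\<close>: the
  \<open>N\<close>-th difference of the orbit at \<open>y\<close> is \<open>T y\<close> applied to
  \<open>(T v - 1) ^ N\<close> of \<open>g\<close>. Abstract \<open>T\<close> and \<open>U\<close>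
  cover functions and distributions; \<open>U_T\<close> is the rule for moving a translation past a
  linear change of variables.\<close>

theorem translations_unipotent:
  fixes V :: "('a \<Rightarrow> real) set" and G :: "(real^'n^'n) set" and z0 :: "real^'n"
    and T :: "real^'n \<Rightarrow> ('a \<Rightarrow> real) \<Rightarrow> 'a \<Rightarrow> real"
    and U :: "real^'n^'n \<Rightarrow> ('a \<Rightarrow> real) \<Rightarrow> 'a \<Rightarrow> real"
  assumes G: "subgroup_GL G" and int: "interior (Lambda_set G z0) \<noteq> {}"
    and fin: "fin_dim_subspace V"
    and T_lin: "\<And>h. linear_op (T h)" and T_V: "\<And>h g. g \<in> V \<Longrightarrow> T h g \<in> V"
    and U_lin: "\<And>P. linear_op (U P)" and U_V: "\<And>P g. P \<in> G \<Longrightarrow> g \<in> V \<Longrightarrow> U P g \<in> V"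
    and T_add: "\<And>h k g. g \<in> V \<Longrightarrow> T h (T k g) = T (h + k) g"
    and U_T: "\<And>P h g. P \<in> G \<Longrightarrow> g \<in> V \<Longrightarrow> U P (T (P *v h) g) = T h (U P g)"
    and U_inv: "\<And>P g. P \<in> G \<Longrightarrow> g \<in> V \<Longrightarrow> U (matrix_inv P) (U P g) = g"
  shows "\<exists>N. \<forall>g\<in>V. \<forall>a v. (fdiff v ^^ N) (\<lambda>y. T y g a) = (\<lambda>_. 0)"
proof -
  define L where "L n = T (real n *\<^sub>R z0)" for n
  define R where "R n = T (- (real n *\<^sub>R z0))" for n
  obtain I q where I: "finite I" and q: "\<exists>n\<in>I. q n \<noteq> 0" and
    rel: "\<And>X g. linear_op X \<Longrightarrow> (\<forall>g\<in>V. X g \<in> V) \<Longrightarrow> g \<in> V \<Longrightarrow>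
       (\<lambda>x. \<Sum>n\<in>I. q n * L n (X (R n g)) x) = (\<lambda>_. 0)"
    using uniform_sandwich_relation[OF fin, of L R] T_lin T_V unfolding L_def R_def by blast
  obtain m where m: "m \<in> I" "q m \<noteq> 0" using q by blast
  define N where "N = card (I - {m})"
  obtain h0 r where r: "r > 0" "ball h0 r \<subseteq> Lambda_set G z0"
    using int by (meson equals0I mem_interior)
  have ann: "(\<lambda>x. \<Sum>n\<in>I. q n * T (real n *\<^sub>R h) g x) = (\<lambda>_. 0)" if h: "h \<in> ball h0 r" and g: "g \<in> V" for h g
  proof -
    obtain P Q where PQ: "P \<in> G" "Q \<in> G" and hPQ: "h = P *v z0 - Q *v z0"
      using h r(2) by (auto simp: Lambda_set_def)
    note P' = subgroup_GL_inverse[OF G PQ(1)] and Q' = subgroup_GL_inverse[OF G PQ(2)]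
    define X where "X f = U P (U (matrix_inv Q) f)" for f
    define g' where "g' = U Q g"
    have X: "linear_op X" "\<forall>g\<in>V. X g \<in> V"
      unfolding X_def[abs_def] using linear_op_comp[OF U_lin U_lin] U_V PQ Q' by blast+
    have g': "g' \<in> V" using U_V PQ g by (simp add: g'_def)
    have conj: "T (real n *\<^sub>R h) g = U (matrix_inv P) (L n (X (R n g')))" for n
    proof -
      have "R n g' = U Q (T (Q *v (- (real n *\<^sub>R z0))) g)"
        using U_T[OF PQ(2) g] by (simp add: R_def g'_def)
      then have "U (matrix_inv Q) (R n g') = T (Q *v (- (real n *\<^sub>R z0))) g"
        using U_inv[OF PQ(2) T_V[OF g]] by simp
      then have "L n (X (R n g')) = U P (T (P *v (real n *\<^sub>R z0)) (T (Q *v (- (real n *\<^sub>R z0))) g))"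
        using U_T[OF PQ(1) T_V[OF g]] by (simp add: L_def X_def)
      then have "U (matrix_inv P) (L n (X (R n g'))) =
          T (P *v (real n *\<^sub>R z0)) (T (Q *v (- (real n *\<^sub>R z0))) g)"
        using U_inv[OF PQ(1)] T_V g by simp
      also have "\<dots> = T (real n *\<^sub>R h) g"
      proof -
        have "P *v (real n *\<^sub>R z0) + Q *v (- (real n *\<^sub>R z0)) = real n *\<^sub>R h"
          by (simp add: hPQ matrix_vector_mult_scaleR vec.neg scaleR_diff_right)
        then show ?thesis by (simp only: T_add[OF g])
      qed
      finally show ?thesis by simp
    qed
    have "(\<lambda>x. \<Sum>n\<in>I. q n * T (real n *\<^sub>R h) g x) =
        U (matrix_inv P) (\<lambda>x. \<Sum>n\<in>I. q n * L n (X (R n g')) x)"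
      by (simp add: conj linear_op_sum[OF U_lin])
    also have "\<dots> = U (matrix_inv P) (\<lambda>_. 0)"
      by (simp add: rel[OF X g'])
    also have "\<dots> = (\<lambda>_. 0)"
      using linear_op_sum[OF U_lin, where I = "{}"] by simp
    finally show ?thesis .
  qed
  have "(fdiff v ^^ N) (\<lambda>y. T y g a) = (\<lambda>_. 0)" if g: "g \<in> V" for g a v
  proof (rule fdiff_funpow_eq_0_of_small)
    \<comment> \<open>The bound leaves room for \<open>N\<close> eliminations, each of which shrinks
      the ball by \<open>norm v\<close>; the \<open>+ 1\<close> covers \<open>N = 0\<close>.\<close>
    show "r / (real N + 1) > 0" using r(1) by simp
    fix v :: "real^'n" assume v: "norm v < r / (real N + 1)"
    \<comment> \<open>Normalised so that the surviving \<open>f m\<close> is the orbit function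
      itself.\<close>
    define f where "f n y = q n / q m * T y g a" for n y
    have "real N * norm v \<le> (real N + 1) * norm v" by (simp add: mult_right_mono)
    also have "\<dots> < r" using v by (simp add: field_simps)
    finally have "real (card (I - {m})) * norm v < r" by (simp add: N_def)
    moreover have "f m (y + real m *\<^sub>R h) + (\<Sum>n\<in>I - {m}. f n (y + real n *\<^sub>R h)) = 0"
      if h: "h \<in> ball h0 r" for y h
    proof -
      have "f m (y + real m *\<^sub>R h) + (\<Sum>n\<in>I - {m}. f n (y + real n *\<^sub>R h))
          = (\<Sum>n\<in>I. f n (y + real n *\<^sub>R h))"
        by (rule sum.remove[OF I m(1), symmetric])
      \<comment> \<open>The relation is used for the translated element \<open>T y g\<close>, which
        is again in \<open>V\<close>.\<close>
      also have "\<dots> = (1 / q m) * (\<Sum>n\<in>I. q n * T (real n *\<^sub>R h) (T y g) a)"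
        unfolding sum_distrib_left by (rule sum.cong) (simp_all add: f_def T_add[OF g] add.commute)
      also have "\<dots> = 0" using fun_cong[OF ann[OF h T_V[OF g]]] by simp
      finally show ?thesis .
    qed
    ultimately have "(fdiff v ^^ card (I - {m})) (f m) = (\<lambda>_. 0)"
      using I by (intro fdiff_eliminate[where r = r and ?h0.0 = h0]) auto
    then show "(fdiff v ^^ N) (\<lambda>y. T y g a) = (\<lambda>_. 0)"
      using m(2) by (simp add: N_def f_def[abs_def])
  qed
  then show ?thesis by blast
qed

section \<open>Smooth functions and test functions\<close>

lemma smooth_fun_continuous: "smooth_fun g \<Longrightarrow> continuous_on UNIV (pderivs is g)"
  by (simp add: smooth_fun_def)

lemma smooth_fun_continuous_self: "smooth_fun g \<Longrightarrow> continuous_on UNIV g"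
  using smooth_fun_continuous[of g "[]"] by simp

lemma smooth_fun_partial_at_0:
  assumes "smooth_fun g"
  shows "((\<lambda>t. pderivs is g (x + t *\<^sub>R axis i 1)) has_real_derivative pderivs (i # is) g x) (at 0)"
proof -
  obtain D where "((\<lambda>t. pderivs is g (x + t *\<^sub>R axis i 1)) has_real_derivative D) (at 0)"
    using assms unfolding smooth_fun_def real_differentiable_def by blast
  then show ?thesis by (simp add: DERIV_imp_deriv)
qed

lemma smooth_fun_partial:
  assumes "smooth_fun g"
  shows "((\<lambda>t. pderivs is g (x + t *\<^sub>R axis i 1)) has_real_derivative
    pderivs (i # is) g (x + s *\<^sub>R axis i 1)) (at s)"
proof -
  have "((\<lambda>t. pderivs is g (x + s *\<^sub>R axis i 1 + t *\<^sub>R axis i 1)) has_real_derivative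
      pderivs (i # is) g (x + s *\<^sub>R axis i 1)) (at (s + - s))"
    using smooth_fun_partial_at_0[OF assms, of "is" "x + s *\<^sub>R axis i 1" i] by simp
  from DERIV_shift[THEN iffD1, OF this]
  show ?thesis by (simp add: algebra_simps)
qed

text \<open>A function is shown smooth by naming all its iterated partial derivatives in advance;
  the recursion for \<open>pderivs\<close> then identifies them.\<close>

lemma smooth_fun_familyI:
  assumes "H [] = g" and "\<And>is. continuous_on UNIV (H is)"
    and der: "\<And>is i x. ((\<lambda>t. H is (x + t *\<^sub>R axis i 1)) has_real_derivative H (i # is) x) (at 0)"
  shows "smooth_fun g" "pderivs is g = H is"
proof -
  have eq: "pderivs is g = H is" for "is"
  proof (induction "is")
    case (Cons i "is")
    show ?case using DERIV_imp_deriv[OF der] by (auto simp: Cons)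
  qed (simp add: assms)
  then show "pderivs is g = H is" .
  show "smooth_fun g"
    unfolding smooth_fun_def eq
    using assms(2) der real_differentiable_def by blast
qed

text \<open>The linear span of \<open>A\<close>, given inductively so that continuity and
  differentiability pass to it by rule induction.\<close>

inductive_set lin_closure :: "('a \<Rightarrow> real) set \<Rightarrow> ('a \<Rightarrow> real) set" for A where
  base: "f \<in> A \<Longrightarrow> f \<in> lin_closure A"
| zero: "(\<lambda>_. 0) \<in> lin_closure A"
| add: "f \<in> lin_closure A \<Longrightarrow> g \<in> lin_closure A \<Longrightarrow> (\<lambda>x. f x + g x) \<in> lin_closure A"
| scale: "f \<in> lin_closure A \<Longrightarrow> (\<lambda>x. c * f x) \<in> lin_closure A"

lemma lin_closure_sum:
  "(\<And>k. k \<in> K \<Longrightarrow> f k \<in> lin_closure A) \<Longrightarrow> (\<lambda>x. \<Sum>k\<in>K. c k * f k x) \<in> lin_closure A"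
proof (induction K rule: infinite_finite_induct)
  case (insert k K)
  then have "(\<lambda>x. c k * f k x + (\<Sum>k\<in>K. c k * f k x)) \<in> lin_closure A"
    by (intro lin_closure.add lin_closure.scale) auto
  then show ?case using insert.hyps by simp
qed (auto intro: lin_closure.zero)

text \<open>It suffices that the derivatives of the generators stay in the span. The product rule
  and the chain rule each give this in one step, with no formula for higher derivatives.\<close>

lemma smooth_fun_lin_closure:
  assumes cont: "\<And>f. f \<in> A \<Longrightarrow> continuous_on UNIV f"
    and der: "\<And>f i. f \<in> A \<Longrightarrow> \<exists>f'\<in>lin_closure A.
      \<forall>x. ((\<lambda>t. f (x + t *\<^sub>R axis i 1)) has_real_derivative f' x) (at 0)"
    and f: "f \<in> lin_closure A"
  shows "smooth_fun f"
proof -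
  have cont': "continuous_on UNIV f" if "f \<in> lin_closure A" for f
    using that by induction (auto intro: cont intro!: continuous_on_add continuous_on_mult)
  have "\<exists>f'\<in>lin_closure A. \<forall>x. ((\<lambda>t. f (x + t *\<^sub>R axis i 1)) has_real_derivative f' x) (at 0)"
    if "f \<in> lin_closure A" for f i
    using that
  proof induction
    case (base f)
    then show ?case by (rule der)
  next
    case zero
    show ?case by (intro bexI[of _ "\<lambda>_. 0"]) (auto intro: lin_closure.zero)
  next
    case (add f g)
    then obtain f' g' where "f' \<in> lin_closure A" "g' \<in> lin_closure A"
      "\<And>x. ((\<lambda>t. f (x + t *\<^sub>R axis i 1)) has_real_derivative f' x) (at 0)"
      "\<And>x. ((\<lambda>t. g (x + t *\<^sub>R axis i 1)) has_real_derivative g' x) (at 0)" by blast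
    then show ?case
      by (intro bexI[of _ "\<lambda>x. f' x + g' x"] allI DERIV_add) (auto intro: lin_closure.add)
  next
    case (scale f c)
    then obtain f' where "f' \<in> lin_closure A"
      "\<And>x. ((\<lambda>t. f (x + t *\<^sub>R axis i 1)) has_real_derivative f' x) (at 0)" by blast
    then show ?case
      by (intro bexI[of _ "\<lambda>x. c * f' x"] allI DERIV_cmult) (auto intro: lin_closure.scale)
  qed
  then have "\<forall>i f. \<exists>f'. f \<in> lin_closure A \<longrightarrow> f' \<in> lin_closure A \<and>
      (\<forall>x. ((\<lambda>t. f (x + t *\<^sub>R axis i 1)) has_real_derivative f' x) (at 0))"
    by blast
  then obtain D where D: "\<And>i f. f \<in> lin_closure A \<Longrightarrow> D i f \<in> lin_closure A"
    "\<And>i f x. f \<in> lin_closure A \<Longrightarrow> ((\<lambda>t. f (x + t *\<^sub>R axis i 1)) has_real_derivative D i f x) (at 0)"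
    by metis
  define H where "H is = foldr D is f" for "is"
  have H: "H is \<in> lin_closure A" for "is"
    by (induction "is") (auto simp: H_def f D(1))
  show ?thesis
  proof (rule smooth_fun_familyI(1)[of H])
    show "((\<lambda>t. H is (x + t *\<^sub>R axis i 1)) has_real_derivative H (i # is) x) (at 0)" for "is" i x
      using D(2)[OF H] by (simp add: H_def)
  qed (auto simp: H cont' H_def[of "[]"])
qed

lemma smooth_fun_pderivs: "smooth_fun g \<Longrightarrow> smooth_fun (pderivs is g)"
proof (rule smooth_fun_familyI(1)[of "\<lambda>js. pderivs (js @ is) g"])
  fix js i x assume "smooth_fun g"
  from smooth_fun_partial_at_0[OF this, of "js @ is" x i]
  show "((\<lambda>t. pderivs (js @ is) g (x + t *\<^sub>R axis i 1)) has_real_derivative pderivs ((i # js) @ is) g x) (at 0)"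
    by simp
qed (auto simp: smooth_fun_continuous)

lemma smooth_fun_mult:
  assumes "smooth_fun a" "smooth_fun b"
  shows "smooth_fun (\<lambda>x. a x * b x)"
proof (rule smooth_fun_lin_closure)
  let ?A = "{\<lambda>x. a x * b x | a b :: real^'n \<Rightarrow> real. smooth_fun a \<and> smooth_fun b}"
  show "(\<lambda>x. a x * b x) \<in> lin_closure ?A"
    using assms by (intro lin_closure.base) blast
  show "continuous_on UNIV f" if "f \<in> ?A" for f
    using that by (auto intro!: continuous_on_mult intro: smooth_fun_continuous_self)
  fix f i assume "f \<in> ?A"
  then obtain a b where f: "f = (\<lambda>x. a x * b x)" and ab: "smooth_fun a" "smooth_fun b" by blast
  define f' where "f' x = pderivs [i] a x * b x + a x * pderivs [i] b x" for x
  have "f' \<in> lin_closure ?A"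
    unfolding f'_def[abs_def]
    by (intro lin_closure.add lin_closure.base; use ab smooth_fun_pderivs in blast)
  moreover have "((\<lambda>t. f (x + t *\<^sub>R axis i 1)) has_real_derivative f' x) (at 0)" for x
    using DERIV_mult[OF smooth_fun_partial_at_0[OF ab(1), of "[]" x i] smooth_fun_partial_at_0[OF ab(2), of "[]" x i]]
    by (simp add: f f'_def mult.commute)
  ultimately show "\<exists>f'\<in>lin_closure ?A. \<forall>x. ((\<lambda>t. f (x + t *\<^sub>R axis i 1)) has_real_derivative f' x) (at 0)"
    by blast
qed

text \<open>Smoothness is defined through coordinate directions only, whereas composing with a
  matrix differentiates in oblique ones. Continuity of the partial derivatives bridges this:
  coordinates are changed one at a time, each by the mean value theorem.\<close>

lemma smooth_fun_has_derivative:
  fixes g :: "real^'n \<Rightarrow> real"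
  assumes g: "smooth_fun g"
  shows "(g has_derivative (\<lambda>v. \<Sum>i\<in>UNIV. v $ i * pderivs [i] g x)) (at x)"
  unfolding has_derivative_at_alt
proof (intro conjI allI impI)
  show "bounded_linear (\<lambda>v::real^'n. \<Sum>i\<in>UNIV. v $ i * pderivs [i] g x)"
    by (intro bounded_linear_sum bounded_linear_mult_const bounded_linear_vec_nth)
  fix e :: real assume "e > 0"
  define \<epsilon> where "\<epsilon> = e / real CARD('n)"
  have eps: "\<epsilon> > 0" using \<open>e > 0\<close> by (simp add: \<epsilon>_def)
  have "\<exists>d>0. \<forall>y. norm (y - x) < d \<longrightarrow> \<bar>pderivs [i] g y - pderivs [i] g x\<bar> < \<epsilon>" for i
    using smooth_fun_continuous[OF g, of "[i]"] eps
    unfolding continuous_on_iff by (metis UNIV_I dist_norm real_norm_def)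
  then obtain d where d: "\<And>i. d i > 0"
    "\<And>i y. norm (y - x) < d i \<Longrightarrow> \<bar>pderivs [i] g y - pderivs [i] g x\<bar> < \<epsilon>"
    by metis
  \<comment> \<open>A vector whose \<open>CARD('n)\<close> coordinates are all below this has norm
    below every \<open>d i\<close>.\<close>
  define \<delta> where "\<delta> = Min (range d) / real CARD('n)"
  have dm: "Min (range d) > 0" "\<And>i. Min (range d) \<le> d i" using d(1) by auto
  have delta: "\<delta> > 0" using dm(1) by (simp add: \<delta>_def)
  have "norm (g y - g x - (\<Sum>i\<in>UNIV. (y - x) $ i * pderivs [i] g x)) \<le> e * norm (y - x)"
    if y: "norm (y - x) < \<delta>" for y
  proof -
    define v where "v = y - x"
    define vS where "vS S = (\<Sum>i\<in>S. v $ i *\<^sub>R axis i (1::real))" for S :: "'n set"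
    have vi: "\<bar>v $ i\<bar> < \<delta>" for i
      using component_le_norm_cart[of v i] y by (simp add: v_def)
    have close: "norm (\<Sum>i\<in>UNIV. c i *\<^sub>R axis i (1::real)) < Min (range d)" if c: "\<And>i. \<bar>c i\<bar> < \<delta>" for c :: "'n \<Rightarrow> real"
    proof -
      have "norm (\<Sum>i\<in>UNIV. c i *\<^sub>R axis i (1::real)) \<le> (\<Sum>i\<in>UNIV. \<bar>c i\<bar>)"
        by (rule order_trans[OF norm_sum]) (simp add: norm_axis_1)
      also have "\<dots> < (\<Sum>i\<in>(UNIV::'n set). \<delta>)"
        by (rule sum_strict_mono) (auto intro: c)
      also have "\<dots> = Min (range d)" by (simp add: \<delta>_def)
      finally show ?thesis .
    qed
    have "\<bar>g (x + vS S) - g x - (\<Sum>i\<in>S. v $ i * pderivs [i] g x)\<bar> \<le> (\<Sum>i\<in>S. \<epsilon> * \<bar>v $ i\<bar>)" for S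
    proof (induction S rule: infinite_finite_induct)
      case (insert i S)
      define u where "u t = g (x + vS S + t *\<^sub>R axis i 1)" for t
      have du: "(u has_real_derivative pderivs [i] g (x + vS S + t *\<^sub>R axis i 1)) (at t)" for t
        using smooth_fun_partial[OF g, of "[]" "x + vS S" i t] by (simp add: u_def[abs_def])
      have near: "\<bar>pderivs [i] g (x + vS S + t *\<^sub>R axis i 1) - pderivs [i] g x\<bar> \<le> \<epsilon>" if "\<bar>t\<bar> \<le> \<bar>v $ i\<bar>" for t
      proof -
        \<comment> \<open>The intermediate points have coordinates no larger than those of
          \<open>v\<close>, which keeps them where the partial derivatives are close to their values
          at \<open>x\<close>.\<close>
        define c where "c j = (if j = i then t else if j \<in> S then v $ j else 0)" for j
        have "vS S + t *\<^sub>R axis i 1 = (\<Sum>j\<in>insert i S. c j *\<^sub>R axis j 1)"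
        proof -
          have "(\<Sum>j\<in>S. c j *\<^sub>R axis j (1::real)) = vS S"
            unfolding vS_def by (rule sum.cong) (use insert in \<open>auto simp: c_def\<close>)
          then show ?thesis using insert by (simp add: c_def add.commute)
        qed
        also have "\<dots> = (\<Sum>j\<in>UNIV. c j *\<^sub>R axis j 1)"
          by (rule sum.mono_neutral_left) (auto simp: c_def)
        finally have eq: "vS S + t *\<^sub>R axis i 1 = (\<Sum>j\<in>UNIV. c j *\<^sub>R axis j 1)" .
        have "\<bar>c j\<bar> < \<delta>" for j
          using that vi[of j] vi[of i] delta by (auto simp: c_def)
        then have "norm (vS S + t *\<^sub>R axis i 1) < d i"
          unfolding eq using close dm(2)[of i] by (meson order_less_le_trans)
        then show ?thesis
          using d(2)[where i = i and y = "x + vS S + t *\<^sub>R axis i 1"] by (simp add: add.assoc)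
      qed
      have "\<exists>t. \<bar>t\<bar> \<le> \<bar>v $ i\<bar> \<and> u (v $ i) - u 0 = v $ i * pderivs [i] g (x + vS S + t *\<^sub>R axis i 1)"
      proof (cases "v $ i" "0 :: real" rule: linorder_cases)
        case less
        from MVT2[OF less du] obtain t where "v $ i < t" "t < 0"
          "u 0 - u (v $ i) = (0 - v $ i) * pderivs [i] g (x + vS S + t *\<^sub>R axis i 1)" by blast
        then show ?thesis by (intro exI[of _ t]) (auto simp: algebra_simps)
      next
        case equal
        then show ?thesis by (intro exI[of _ 0]) simp
      next
        case greater
        from MVT2[OF greater du] obtain t where "0 < t" "t < v $ i"
          "u (v $ i) - u 0 = (v $ i - 0) * pderivs [i] g (x + vS S + t *\<^sub>R axis i 1)" by blast
        then show ?thesis by (intro exI[of _ t]) auto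
      qed
      then obtain t where t: "\<bar>t\<bar> \<le> \<bar>v $ i\<bar>"
        "u (v $ i) - u 0 = v $ i * pderivs [i] g (x + vS S + t *\<^sub>R axis i 1)" by blast
      have "\<bar>u (v $ i) - u 0 - v $ i * pderivs [i] g x\<bar> =
          \<bar>v $ i\<bar> * \<bar>pderivs [i] g (x + vS S + t *\<^sub>R axis i 1) - pderivs [i] g x\<bar>"
        by (simp only: t(2) right_diff_distrib[symmetric] abs_mult)
      also have "\<dots> \<le> \<epsilon> * \<bar>v $ i\<bar>"
        using mult_left_mono[OF near[OF t(1)], of "\<bar>v $ i\<bar>"] by (simp add: mult.commute)
      finally have step: "\<bar>u (v $ i) - u 0 - v $ i * pderivs [i] g x\<bar> \<le> \<epsilon> * \<bar>v $ i\<bar>" .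
      have u0: "u 0 = g (x + vS S)" and ui: "u (v $ i) = g (x + vS (insert i S))"
        using insert by (simp_all add: u_def vS_def algebra_simps)
      show ?case
        using insert step unfolding u0 ui by simp
    qed (simp_all add: vS_def)
    from this[of UNIV] have "\<bar>g (x + vS UNIV) - g x - (\<Sum>i\<in>UNIV. v $ i * pderivs [i] g x)\<bar> \<le> (\<Sum>i\<in>UNIV. \<epsilon> * \<bar>v $ i\<bar>)" .
    also have "(\<Sum>i\<in>UNIV. \<epsilon> * \<bar>v $ i\<bar>) \<le> (\<Sum>i\<in>(UNIV::'n set). \<epsilon> * norm v)"
      by (intro sum_mono mult_left_mono component_le_norm_cart) (use eps in auto)
    also have "\<dots> = e * norm v" by (simp add: \<epsilon>_def)
    also have "vS UNIV = v"
      unfolding vS_def using basis_expansion[of v] by (simp add: scalar_mult_eq_scaleR)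
    finally show ?thesis by (simp add: v_def)
  qed
  then show "\<exists>d>0. \<forall>y. norm (y - x) < d \<longrightarrow>
      norm (g y - g x - (\<Sum>i\<in>UNIV. (y - x) $ i * pderivs [i] g x)) \<le> e * norm (y - x)"
    using delta by blast
qed

lemma smooth_fun_matrix:
  fixes a :: "real^'n \<Rightarrow> real" and A :: "real^'n^'n"
  assumes "smooth_fun a"
  shows "smooth_fun (\<lambda>x. a (A *v x))"
proof (rule smooth_fun_lin_closure)
  let ?A = "{\<lambda>x. a (A *v x) | a. smooth_fun a}"
  show "(\<lambda>x. a (A *v x)) \<in> lin_closure ?A"
    using assms by (intro lin_closure.base) blast
  have lin: "continuous_on UNIV ((*v) A)"
    by (intro linear_continuous_on bounded_linearI' ) (simp_all add: matrix_vector_right_distrib matrix_vector_mult_scaleR)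
  show "continuous_on UNIV f" if "f \<in> ?A" for f
    using that by (auto intro!: continuous_on_compose2[OF smooth_fun_continuous_self lin])
  fix f i assume "f \<in> ?A"
  then obtain a where f: "f = (\<lambda>x. a (A *v x))" and a: "smooth_fun a" by blast
  define f' where "f' x = (\<Sum>j\<in>UNIV. (A *v axis i 1) $ j * pderivs [j] a (A *v x))" for x
  have "f' \<in> lin_closure ?A"
    unfolding f'_def[abs_def]
    by (intro lin_closure_sum lin_closure.base) (use a smooth_fun_pderivs in blast)
  moreover have "((\<lambda>t. f (x + t *\<^sub>R axis i 1)) has_real_derivative f' x) (at 0)" for x
  proof -
    have inner: "((\<lambda>t. A *v x + t *\<^sub>R (A *v axis i 1)) has_derivative (\<lambda>t. t *\<^sub>R (A *v axis i 1))) (at 0)"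
      by (auto intro!: derivative_eq_intros)
    have outer: "(a has_derivative (\<lambda>v. \<Sum>j\<in>UNIV. v $ j * pderivs [j] a (A *v x)))
        (at (A *v x + 0 *\<^sub>R (A *v axis i 1)))"
      using smooth_fun_has_derivative[OF a, of "A *v x"] by simp
    from has_derivative_compose[OF inner outer]
    have "((\<lambda>t. a (A *v x + t *\<^sub>R (A *v axis i 1))) has_derivative (\<lambda>t. t * f' x)) (at 0)"
      by (simp add: f'_def sum_distrib_left mult.assoc)
    then show ?thesis
      by (simp add: f has_field_derivative_def matrix_vector_right_distrib matrix_vector_mult_scaleR mult_commute_abs)
  qed
  ultimately show "\<exists>f'\<in>lin_closure ?A. \<forall>x. ((\<lambda>t. f (x + t *\<^sub>R axis i 1)) has_real_derivative f' x) (at 0)"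
    by blast
qed

text \<open>One statement yields translation, linear combination and the Riemann sums of a
  convolution, together with their derivatives.\<close>

lemma smooth_fun_translates:
  fixes \<phi> :: "'k \<Rightarrow> real^'n \<Rightarrow> real"
  assumes "\<And>k. k \<in> K \<Longrightarrow> smooth_fun (\<phi> k)"
  shows "smooth_fun (\<lambda>x. \<Sum>k\<in>K. c k * \<phi> k (x - s k))"
    "pderivs is (\<lambda>x. \<Sum>k\<in>K. c k * \<phi> k (x - s k)) = (\<lambda>x. \<Sum>k\<in>K. c k * pderivs is (\<phi> k) (x - s k))"
proof -
  let ?H = "\<lambda>is x. \<Sum>k\<in>K. c k * pderivs is (\<phi> k) (x - s k)"
  have 1: "?H [] = (\<lambda>x. \<Sum>k\<in>K. c k * \<phi> k (x - s k))" by simp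
  have 2: "continuous_on UNIV (?H is)" for "is"
    by (intro continuous_intros continuous_on_compose2[OF smooth_fun_continuous[OF assms]]) auto
  have 3: "((\<lambda>t. ?H is (x + t *\<^sub>R axis i 1)) has_real_derivative ?H (i # is) x) (at 0)" for "is" i x
  proof (intro DERIV_sum DERIV_cmult)
    fix k assume "k \<in> K"
    from smooth_fun_partial_at_0[OF assms[OF this], of "is" "x - s k" i]
    show "((\<lambda>t. pderivs is (\<phi> k) (x + t *\<^sub>R axis i 1 - s k)) has_real_derivative pderivs (i # is) (\<phi> k) (x - s k)) (at 0)"
      by (simp add: algebra_simps)
  qed
  show "smooth_fun (\<lambda>x. \<Sum>k\<in>K. c k * \<phi> k (x - s k))"
    "pderivs is (\<lambda>x. \<Sum>k\<in>K. c k * \<phi> k (x - s k)) = ?H is"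
    using smooth_fun_familyI[of ?H, OF 1 2 3] by auto
qed

text \<open>The exterior of a closed ball is open, so near \<open>x\<close> the function whose
  derivative is taken is constantly zero.\<close>

lemma pderivs_vanish:
  fixes \<phi> :: "real^'n \<Rightarrow> real"
  assumes "\<And>x. norm x > R \<Longrightarrow> \<phi> x = 0" "norm x > R"
  shows "pderivs is \<phi> x = 0"
  using assms(2)
proof (induction "is" arbitrary: x)
  case (Cons i "is")
  have "((\<lambda>t. norm (x + t *\<^sub>R axis i 1)) \<longlongrightarrow> norm (x + 0 *\<^sub>R axis i 1)) (at 0)"
    by (intro tendsto_intros)
  then have "\<forall>\<^sub>F t in at 0. norm (x + t *\<^sub>R axis i 1) > R"
    using Cons.prems by (auto dest: order_tendstoD(1)[where a = R])
  then have "\<forall>\<^sub>F t in nhds 0. pderivs is \<phi> (x + t *\<^sub>R axis i 1) = 0"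
    using Cons by (auto simp: eventually_at_filter elim: eventually_mono)
  from deriv_cong_ev[OF this refl] show ?case by simp
qed (use assms(1) in simp)

section \<open>Test functions\<close>

lemma test_fun_iff:
  "test_fun \<phi> \<longleftrightarrow> smooth_fun \<phi> \<and> (\<exists>R. \<forall>x. norm x > R \<longrightarrow> \<phi> x = 0)"
proof -
  have "compact (closure {x. \<phi> x \<noteq> 0}) \<longleftrightarrow> (\<exists>R. \<forall>x. norm x > R \<longrightarrow> \<phi> x = 0)"
    unfolding compact_closure bounded_iff by (auto simp: not_le[symmetric])
  then show ?thesis by (simp add: test_fun_def)
qed

lemma test_fun_smooth: "test_fun \<phi> \<Longrightarrow> smooth_fun \<phi>"
  by (simp add: test_fun_def)

lemma test_fun_radius:
  assumes "test_fun \<phi>" obtains R where "R > 0" "\<And>x. norm x > R \<Longrightarrow> \<phi> x = 0"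
proof -
  obtain R where "\<And>x. norm x > R \<Longrightarrow> \<phi> x = 0" using assms test_fun_iff by blast
  then show thesis using that[of "max R 1"] by auto
qed

lemma test_fun_translates:
  fixes \<phi> :: "'k \<Rightarrow> real^'n \<Rightarrow> real"
  assumes "\<And>k. k \<in> K \<Longrightarrow> test_fun (\<phi> k)"
  shows "test_fun (\<lambda>x. \<Sum>k\<in>K. c k * \<phi> k (x - s k))"
proof -
  have "\<exists>R. \<forall>x. norm x > R \<longrightarrow> (\<Sum>k\<in>K. c k * \<phi> k (x - s k)) = 0"
    using assms
  proof (induction K rule: infinite_finite_induct)
    case (insert k K)
    then obtain R where R: "\<And>x. norm x > R \<Longrightarrow> (\<Sum>k\<in>K. c k * \<phi> k (x - s k)) = 0" by auto
    obtain S where S: "\<And>x. norm x > S \<Longrightarrow> \<phi> k x = 0"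
      using insert.prems test_fun_radius by (metis insertI1)
    have "(\<Sum>k\<in>insert k K. c k * \<phi> k (x - s k)) = 0" if "norm x > max R (S + norm (s k))" for x
      using that R[of x] S[of "x - s k"] norm_triangle_ineq2[of x "s k"] insert.hyps by auto
    then show ?case by blast
  qed auto
  then show ?thesis
    using smooth_fun_translates(1)[of K \<phi> c s] assms test_fun_smooth test_fun_iff by blast
qed

lemma test_fun_translate: "test_fun \<phi> \<Longrightarrow> test_fun (\<lambda>x. \<phi> (x - h))"
  using test_fun_translates[of "{()}" "\<lambda>_. \<phi>" "\<lambda>_. 1" "\<lambda>_. h"] by simp

lemma pderivs_translate: "test_fun \<phi> \<Longrightarrow> pderivs is (\<lambda>x. \<phi> (x - h)) = (\<lambda>x. pderivs is \<phi> (x - h))"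
  using smooth_fun_translates(2)[of "{()}" "\<lambda>_. \<phi>" "is" "\<lambda>_. 1" "\<lambda>_. h"] by (simp add: test_fun_smooth)

lemma test_fun_sum:
  "(\<And>k. k \<in> K \<Longrightarrow> test_fun (\<phi> k)) \<Longrightarrow> test_fun (\<lambda>x. \<Sum>k\<in>K. c k * \<phi> k x)"
  using test_fun_translates[of K \<phi> c "\<lambda>_. 0"] by simp

lemma test_fun_mult:
  assumes "test_fun a" "test_fun b"
  shows "test_fun (\<lambda>x. a x * b x)"
proof -
  obtain R where "\<And>x. norm x > R \<Longrightarrow> a x = 0" using test_fun_radius[OF assms(1)] by metis
  then show ?thesis
    using smooth_fun_mult[of a b] assms by (auto simp: test_fun_iff)
qed

text \<open>The left inverse bounds \<open>norm x\<close> by a multiple of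
  \<open>norm (A *v x)\<close>, so the support remains bounded.\<close>

lemma test_fun_matrix:
  fixes A B :: "real^'n^'n"
  assumes "test_fun \<phi>" "B ** A = mat 1"
  shows "test_fun (\<lambda>x. \<phi> (A *v x))"
proof -
  obtain R where R: "R > 0" "\<And>x. norm x > R \<Longrightarrow> \<phi> x = 0" using test_fun_radius[OF assms(1)] by metis
  have "bounded_linear ((*v) B)"
    by (intro bounded_linearI') (simp_all add: matrix_vector_right_distrib matrix_vector_mult_scaleR)
  then obtain M where M: "M > 0" "\<And>x. norm (B *v x) \<le> norm x * M"
    using bounded_linear.pos_bounded by blast
  have "\<phi> (A *v x) = 0" if "norm x > R * M" for x
  proof -
    have "B *v (A *v x) = x" by (simp add: matrix_vector_mul_assoc assms(2))
    then have "R * M < norm (A *v x) * M" using M(2)[of "A *v x"] that by simp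
    then show ?thesis using R(2) M(1) by simp
  qed
  then show ?thesis
    using smooth_fun_matrix[of \<phi> A] assms(1) by (auto simp: test_fun_iff)
qed

section \<open>Convolution with distributions\<close>

lemma integral_UNIV_eq_cbox:
  fixes g :: "'a::euclidean_space \<Rightarrow> real"
  assumes "\<And>y. y \<notin> cbox a b \<Longrightarrow> g y = 0"
  shows "integral UNIV g = integral (cbox a b) g"
proof -
  have "g = (\<lambda>y. if y \<in> cbox a b then g y else 0)" using assms by auto
  then show ?thesis by (metis integral_restrict_UNIV)
qed

lemma has_integral_UNIV_compact_support:
  fixes g :: "'a::euclidean_space \<Rightarrow> real"
  assumes "continuous_on UNIV g" "\<And>y. norm y > R \<Longrightarrow> g y = 0"
  shows "(g has_integral integral UNIV g) UNIV"
proof -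
  obtain a :: 'a where a: "cball 0 R \<subseteq> cbox (-a) a"
    using bounded_subset_cbox_symmetric[OF bounded_cball] by metis
  have 0: "g y = 0" if "y \<notin> cbox (-a) a" for y
    using a that assms(2)[of y] by (force simp: not_le)
  have "(g has_integral integral (cbox (-a) a) g) (cbox (-a) a)"
    using assms(1) by (intro integrable_integral integrable_continuous) (auto intro: continuous_on_subset)
  from has_integral_on_superset[OF this 0 subset_UNIV] show ?thesis
    using integral_unique by fastforce
qed

text \<open>Applied with \<open>m = -1\<close> for the reflection in a convolution and with
  \<open>m = 1 / k\<close> for the dilates of a kernel.\<close>

lemma integral_UNIV_affine:
  fixes g :: "'a::euclidean_space \<Rightarrow> real"
  assumes g: "continuous_on UNIV g" "\<And>y. norm y > R \<Longrightarrow> g y = 0" and m: "m \<noteq> 0"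
  shows "integral UNIV (\<lambda>y. g (m *\<^sub>R y + c)) = integral UNIV g / \<bar>m\<bar> ^ DIM('a)"
proof -
  obtain a :: 'a where a: "cball 0 R \<subseteq> cbox (-a) a"
    using bounded_subset_cbox_symmetric[OF bounded_cball] by metis
  have 0: "g y = 0" if "y \<notin> cbox (-a) a" for y
    using a that g(2)[of y] by (force simp: not_le)
  have "(g has_integral integral (cbox (-a) a) g) (cbox (-a) a)"
    using g(1) by (intro integrable_integral integrable_continuous) (auto intro: continuous_on_subset)
  from has_integral_affinity[OF this m, of c]
  have int: "((\<lambda>y. g (m *\<^sub>R y + c)) has_integral (1 / \<bar>m\<bar> ^ DIM('a)) *\<^sub>R integral (cbox (-a) a) g)
      ((\<lambda>x. (1 / m) *\<^sub>R x + - ((1 / m) *\<^sub>R c)) ` cbox (-a) a)" .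
  have "g (m *\<^sub>R y + c) = 0" if "y \<notin> (\<lambda>x. (1 / m) *\<^sub>R x + - ((1 / m) *\<^sub>R c)) ` cbox (-a) a" for y
  proof (rule 0, rule notI)
    assume "m *\<^sub>R y + c \<in> cbox (-a) a"
    moreover have "y = (1 / m) *\<^sub>R (m *\<^sub>R y + c) + - ((1 / m) *\<^sub>R c)"
      using m by (simp add: scaleR_add_right)
    ultimately show False using that by blast
  qed
  from has_integral_on_superset[OF int this subset_UNIV] show ?thesis
    using integral_UNIV_eq_cbox[of "-a" a g, OF 0] by (simp add: integral_unique)
qed

lemma compact_support_bounded:
  fixes g :: "'a::euclidean_space \<Rightarrow> real"
  assumes "continuous_on UNIV g" "\<And>x. norm x > R \<Longrightarrow> g x = 0"
  obtains M where "M > 0" "\<And>x. \<bar>g x\<bar> \<le> M"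
proof -
  have "compact (g ` cball 0 R)"
    using assms(1) by (intro compact_continuous_image compact_cball) (auto intro: continuous_on_subset)
  then obtain M where M: "M > 0" "\<And>x. x \<in> cball 0 R \<Longrightarrow> \<bar>g x\<bar> \<le> M"
    using compact_imp_bounded bounded_pos by (metis image_eqI real_norm_def)
  have "\<bar>g x\<bar> \<le> M" for x
    using M assms(2)[of x] by (cases "norm x \<le> R") auto
  then show thesis using that M(1) by blast
qed

lemma compact_support_uniformly_continuous:
  fixes g :: "'a::euclidean_space \<Rightarrow> real"
  assumes "continuous_on UNIV g" "\<And>x. norm x > R \<Longrightarrow> g x = 0" "e > 0"
  obtains d where "d > 0" "\<And>x y. dist x y < d \<Longrightarrow> \<bar>g x - g y\<bar> < e"
proof -
  have "uniformly_continuous_on (cball 0 (R + 1)) g"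
    using assms(1) by (intro compact_uniformly_continuous compact_cball) (auto intro: continuous_on_subset)
  then obtain d where d: "d > 0"
    "\<And>x y. x \<in> cball 0 (R + 1) \<Longrightarrow> y \<in> cball 0 (R + 1) \<Longrightarrow> dist y x < d \<Longrightarrow> dist (g y) (g x) < e"
    using assms(3) unfolding uniformly_continuous_on_def by metis
  have "\<bar>g x - g y\<bar> < e" if "dist x y < min d 1" for x y
  proof (cases "norm x \<le> R + 1 \<and> norm y \<le> R + 1")
    case True
    then show ?thesis using d(2)[of y x] that by (simp add: dist_norm)
  next
    case False
    have "\<bar>norm x - norm y\<bar> < 1" using that norm_triangle_ineq3[of x y] by (simp add: dist_norm)
    then have "norm x > R" "norm y > R" using False by auto
    then show ?thesis using assms(2,3) by simp
  qed
  then show thesis using that[of "min d 1"] d(1) by simp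
qed

text \<open>Each cell lies in the \<open>\<delta>\<close>-ball about its tag, so it contributes at
  most \<open>e\<close> times its volume. The bound involves only the oscillation \<open>e\<close>,
  hence is uniform over families with a common modulus of continuity.\<close>

lemma riemann_sum_bound:
  fixes g :: "'a::euclidean_space \<Rightarrow> real"
  assumes g: "continuous_on (cbox a b) g" and p: "p tagged_division_of cbox a b"
    and fine: "(\<lambda>t. ball t \<delta>) fine p"
    and osc: "\<And>s t. s \<in> cbox a b \<Longrightarrow> t \<in> cbox a b \<Longrightarrow> dist t s < \<delta> \<Longrightarrow> \<bar>g t - g s\<bar> \<le> e" and e: "e \<ge> 0"
  shows "\<bar>(\<Sum>z\<in>p. measure lborel (snd z) * g (fst z)) - integral (cbox a b) g\<bar> \<le> e * measure lborel (cbox a b)"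
proof -
  have "integral (cbox a b) g = (\<Sum>z\<in>p. integral (snd z) g)"
    using integral_combine_tagged_division_topdown[OF integrable_continuous[OF g] p]
    by (simp add: case_prod_beta')
  then have "\<bar>(\<Sum>z\<in>p. measure lborel (snd z) * g (fst z)) - integral (cbox a b) g\<bar>
      = \<bar>\<Sum>z\<in>p. (measure lborel (snd z) * g (fst z) - integral (snd z) g)\<bar>"
    by (simp add: sum_subtractf)
  also have "\<dots> \<le> (\<Sum>z\<in>p. \<bar>measure lborel (snd z) * g (fst z) - integral (snd z) g\<bar>)"
    by (rule sum_abs)
  also have "\<dots> \<le> (\<Sum>z\<in>p. e * measure lborel (snd z))"
  proof (rule sum_mono)
    fix z assume z: "z \<in> p"
    obtain t k where zt: "z = (t, k)" by (cases z)
    note tk = tagged_division_ofD(2-4)[OF p z[unfolded zt]]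
    obtain u v where k: "k = cbox u v" using tk(3) by blast
    have kball: "k \<subseteq> ball t \<delta>" using fine z zt by (auto simp: fine_def)
    have "g integrable_on k"
      unfolding k using g tk(2) k by (intro integrable_continuous) (auto intro: continuous_on_subset)
    then have "((\<lambda>s. g t - g s) has_integral measure lborel k * g t - integral k g) (cbox u v)"
      unfolding k using has_integral_const[of "g t" u v]
      by (intro has_integral_diff integrable_integral) auto
    moreover have "norm (g t - g s) \<le> e" if "s \<in> cbox u v" for s
    proof -
      have "s \<in> k" using that k by simp
      then show ?thesis
        using osc[of s t] tk(1,2) kball by (auto simp: subset_eq)
    qed
    ultimately have "norm (measure lborel k * g t - integral k g) \<le> e * measure lborel (cbox u v)"
      using e by (intro has_integral_bound) auto
    then show "\<bar>measure lborel (snd z) * g (fst z) - integral (snd z) g\<bar> \<le> e * measure lborel (snd z)"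
      by (simp add: zt k)
  qed
  also have "\<dots> = e * measure lborel (cbox a b)"
    using additive_content_tagged_division[OF p]
    by (simp add: sum_distrib_left[symmetric] case_prod_beta')
  finally show ?thesis .
qed

definition conv :: "(real^'n \<Rightarrow> real) \<Rightarrow> (real^'n \<Rightarrow> real) \<Rightarrow> real^'n \<Rightarrow> real" where
  "conv \<psi> \<kappa> x = integral UNIV (\<lambda>y. \<psi> y * \<kappa> (x - y))"

lemma conv_commute:
  assumes "continuous_on UNIV \<psi>" "\<And>y. norm y > R \<Longrightarrow> \<psi> y = 0" "continuous_on UNIV \<kappa>"
  shows "conv \<psi> \<kappa> = conv \<kappa> \<psi>"
proof
  fix x
  have "continuous_on UNIV (\<lambda>y. \<psi> y * \<kappa> (x - y))"
    by (intro continuous_intros continuous_on_compose2[OF assms(3)] assms(1)) auto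
  from integral_UNIV_affine[OF this, of R "-1" x]
  show "conv \<psi> \<kappa> x = conv \<kappa> \<psi> x"
    using assms(2) by (simp add: conv_def mult.commute)
qed

text \<open>Differentiation under the integral sign, over a box that contains the support of
  \<open>\<psi>\<close>; all derivatives fall on \<open>\<kappa>\<close>.\<close>

lemma smooth_fun_conv:
  fixes \<psi> \<kappa> :: "real^'n \<Rightarrow> real"
  assumes psi: "continuous_on UNIV \<psi>" "\<And>y. norm y > R \<Longrightarrow> \<psi> y = 0" and chi: "smooth_fun \<kappa>"
  shows "smooth_fun (conv \<psi> \<kappa>)" "pderivs is (conv \<psi> \<kappa>) = conv \<psi> (pderivs is \<kappa>)"
proof -
  obtain a :: "real^'n" where a: "cball 0 R \<subseteq> cbox (-a) a"
    using bounded_subset_cbox_symmetric[OF bounded_cball] by metis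
  have 0: "\<psi> y = 0" if "y \<notin> cbox (-a) a" for y
    using a that psi(2)[of y] by (force simp: not_le)
  have conv_cbox: "conv \<psi> \<eta> x = integral (cbox (-a) a) (\<lambda>y. \<psi> y * \<eta> (x - y))" for \<eta> x
    unfolding conv_def by (rule integral_UNIV_eq_cbox) (simp add: 0)
  let ?H = "\<lambda>is. conv \<psi> (pderivs is \<kappa>)"
  have 1: "?H [] = conv \<psi> \<kappa>" by simp
  have 2: "continuous_on UNIV (?H is)" for "is"
    unfolding conv_cbox[abs_def]
    by (rule integral_continuous_on_param)
      (auto simp: case_prod_beta' intro!: continuous_intros continuous_on_compose2[OF psi(1)]
        continuous_on_compose2[OF smooth_fun_continuous[OF chi]])
  have 3: "((\<lambda>t. ?H is (x + t *\<^sub>R axis i 1)) has_real_derivative ?H (i # is) x) (at 0)" for "is" i x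
  proof -
    have "((\<lambda>t. integral (cbox (-a) a) (\<lambda>y. \<psi> y * pderivs is \<kappa> (x + t *\<^sub>R axis i 1 - y)))
      has_real_derivative integral (cbox (-a) a) (\<lambda>y. \<psi> y * pderivs (i # is) \<kappa> (x + 0 *\<^sub>R axis i 1 - y))) (at 0 within UNIV)"
    proof (rule leibniz_rule_field_derivative[where U = UNIV and fx = "\<lambda>t y. \<psi> y * pderivs (i # is) \<kappa> (x + t *\<^sub>R axis i 1 - y)"])
      fix t :: real and y :: "real^'n"
      have "((\<lambda>t. pderivs is \<kappa> (x + t *\<^sub>R axis i 1 - y)) has_real_derivative pderivs (i # is) \<kappa> (x + t *\<^sub>R axis i 1 - y)) (at t)"
        using smooth_fun_partial[OF chi, of "is" "x - y" i t] by (simp add: algebra_simps)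
      then show "((\<lambda>t. \<psi> y * pderivs is \<kappa> (x + t *\<^sub>R axis i 1 - y)) has_real_derivative
          \<psi> y * pderivs (i # is) \<kappa> (x + t *\<^sub>R axis i 1 - y)) (at t within UNIV)"
        by (rule DERIV_cmult)
      show "(\<lambda>y. \<psi> y * pderivs is \<kappa> (x + t *\<^sub>R axis i 1 - y)) integrable_on cbox (-a) a"
        by (intro integrable_continuous continuous_intros continuous_on_compose2[OF psi(1)]
            continuous_on_compose2[OF smooth_fun_continuous[OF chi]]) auto
    next
      show "continuous_on (UNIV \<times> cbox (-a) a) (\<lambda>(t, y). \<psi> y * pderivs (i # is) \<kappa> (x + t *\<^sub>R axis i 1 - y))"
        unfolding case_prod_beta'
        by (intro continuous_intros continuous_on_compose2[OF psi(1)]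
            continuous_on_compose2[OF smooth_fun_continuous[OF chi]]) auto
    qed auto
    then show ?thesis by (simp add: conv_cbox del: pderivs.simps)
  qed
  show "smooth_fun (conv \<psi> \<kappa>)" "pderivs is (conv \<psi> \<kappa>) = conv \<psi> (pderivs is \<kappa>)"
    using smooth_fun_familyI[of ?H, OF 1 2 3] by auto
qed

lemma conv_vanish:
  assumes "\<And>y. norm y > R \<Longrightarrow> \<psi> y = 0" "\<And>y. norm y > S \<Longrightarrow> \<kappa> y = 0" "norm x > R + S"
  shows "conv \<psi> \<kappa> x = 0"
proof -
  have "\<psi> y * \<kappa> (x - y) = 0" for y
    using assms(1)[of y] assms(2)[of "x - y"] assms(3) norm_triangle_ineq2[of x y]
    by (cases "norm y > R") auto
  then show ?thesis unfolding conv_def by (simp only: integral_0)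
qed

section \<open>Distributions and limits of test functions\<close>

lemma distribution_linear:
  assumes "distribution f" "test_fun \<phi>" "test_fun \<psi>"
  shows "f (\<lambda>x. a * \<phi> x + b * \<psi> x) = a * f \<phi> + b * f \<psi>"
  using assms by (simp add: distribution_def)

lemma distribution_sum:
  assumes f: "distribution f" and "\<And>k. k \<in> K \<Longrightarrow> test_fun (\<phi> k)"
  shows "f (\<lambda>x. \<Sum>k\<in>K. c k * \<phi> k x) = (\<Sum>k\<in>K. c k * f (\<phi> k))"
  using assms(2)
proof (induction K rule: infinite_finite_induct)
  case (infinite K)
  have "test_fun (\<lambda>_. 0)" using test_fun_sum[of "{}"] by simp
  from distribution_linear[OF f this this, of 0 0] infinite show ?case by simp
next
  case empty
  have "test_fun (\<lambda>_. 0)" using test_fun_sum[of "{}"] by simp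
  from distribution_linear[OF f this this, of 0 0] show ?case by simp
next
  case (insert k K)
  have "test_fun (\<lambda>x. \<Sum>k\<in>K. c k * \<phi> k x)" by (rule test_fun_sum) (use insert in auto)
  from distribution_linear[OF f insert.prems[of k] this, of "c k" 1]
  show ?case using insert by simp
qed

text \<open>Continuity drawn from the seminorm bound. The supports have to lie in a common ball
  because the constants depend on the compact set. A general filter \<open>F\<close> allows both
  sequences and limits at a point.\<close>

lemma distribution_tendsto:
  fixes f :: "(real^'n \<Rightarrow> real) \<Rightarrow> real"
  assumes f: "distribution f" and \<phi>: "test_fun \<phi>" "\<And>x. norm x > R \<Longrightarrow> \<phi> x = 0"
    and \<Phi>: "\<And>n. test_fun (\<Phi> n)" "\<forall>\<^sub>F n in F. \<forall>x. norm x > R \<longrightarrow> \<Phi> n x = 0"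
    and lim: "\<And>is e. e > 0 \<Longrightarrow> \<forall>\<^sub>F n in F. \<forall>x. \<bar>pderivs is (\<Phi> n) x - pderivs is \<phi> x\<bar> \<le> e"
  shows "((\<lambda>n. f (\<Phi> n)) \<longlongrightarrow> f \<phi>) F"
proof (rule tendstoI)
  fix e :: real assume "e > 0"
  obtain C N where CN: "\<And>\<phi>. test_fun \<phi> \<Longrightarrow> closure {x. \<phi> x \<noteq> 0} \<subseteq> cball 0 R \<Longrightarrow>
      \<bar>f \<phi>\<bar> \<le> C * (\<Sum>is\<in>{is :: 'n list. length is \<le> N}. (SUP x. \<bar>pderivs is \<phi> x\<bar>))"
    using f compact_cball[of 0 R] unfolding distribution_def by meson
  let ?L = "{is :: 'n list. length is \<le> N}"
  have fin: "finite ?L" using finite_lists_length_le[of "UNIV :: 'n set" N] by simp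
  \<comment> \<open>\<open>\<bar>C\<bar>\<close> because \<open>C\<close> may be negative,
    \<open>+ 1\<close> to keep the denominator positive and the final inequality strict.\<close>
  define \<epsilon> where "\<epsilon> = e / (\<bar>C\<bar> * real (card ?L) + 1)"
  have pos: "\<bar>C\<bar> * real (card ?L) + 1 > 0"
    by (meson abs_ge_zero add_nonneg_pos mult_nonneg_nonneg of_nat_0_le_iff zero_less_one)
  have eps: "\<epsilon> > 0" using \<open>e > 0\<close> pos by (simp add: \<epsilon>_def)
  have "\<forall>\<^sub>F n in F. \<forall>is\<in>?L. \<forall>x. \<bar>pderivs is (\<Phi> n) x - pderivs is \<phi> x\<bar> \<le> \<epsilon>"
    using fin lim[OF eps] by (intro eventually_ball_finite) auto
  with \<Phi>(2) show "\<forall>\<^sub>F n in F. dist (f (\<Phi> n)) (f \<phi>) < e"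
  proof eventually_elim
    case (elim n)
    define \<psi> where "\<psi> x = \<Phi> n x - \<phi> x" for x
    \<comment> \<open>The difference is written as a combination of translates by 0, so that the
      rules for translates compute its derivatives.\<close>
    have psi_sum: "\<psi> = (\<lambda>x. \<Sum>k\<in>UNIV. (if k then 1 else -1) * (if k then \<Phi> n else \<phi>) (x - 0))"
      by (simp add: \<psi>_def[abs_def] UNIV_bool)
    have "test_fun \<psi>"
      unfolding psi_sum by (rule test_fun_translates) (use \<phi> \<Phi> in auto)
    have pd: "pderivs is \<psi> x = pderivs is (\<Phi> n) x - pderivs is \<phi> x" for "is" x
      unfolding psi_sum
      by (subst smooth_fun_translates(2)) (use \<phi> \<Phi> test_fun_smooth in \<open>auto simp: UNIV_bool\<close>)
    have "f \<psi> = f (\<Phi> n) - f \<phi>"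
      using distribution_linear[OF f \<Phi>(1)[of n] \<phi>(1), of 1 "-1"] by (simp add: \<psi>_def[abs_def])
    moreover have "\<bar>f \<psi>\<bar> \<le> C * (\<Sum>is\<in>?L. (SUP x. \<bar>pderivs is \<psi> x\<bar>))"
    proof (rule CN[OF \<open>test_fun \<psi>\<close>])
      show "closure {x. \<psi> x \<noteq> 0} \<subseteq> cball 0 R"
      proof (rule closure_minimal)
        have "\<psi> x = 0" if "\<not> norm x \<le> R" for x
          using elim(1) \<phi>(2) that by (simp add: \<psi>_def)
        then show "{x. \<psi> x \<noteq> 0} \<subseteq> cball 0 R"
          unfolding subset_iff mem_Collect_eq mem_cball_0 by blast
      qed simp
    qed
    moreover have "C * (\<Sum>is\<in>?L. (SUP x. \<bar>pderivs is \<psi> x\<bar>)) \<le> \<bar>C\<bar> * (\<Sum>is\<in>?L. \<epsilon>)"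
    proof -
      have bd: "\<bar>pderivs is \<psi> x\<bar> \<le> \<epsilon>" if "is \<in> ?L" for "is" x
        using elim(2) that by (simp add: pd)
      \<comment> \<open>Nonnegative suprema are what permits replacing \<open>C\<close> by
        \<open>\<bar>C\<bar>\<close>.\<close>
      have "0 \<le> (SUP x. \<bar>pderivs is \<psi> x\<bar>)" if "is \<in> ?L" for "is"
      proof (rule cSUP_upper2[of _ _ 0])
        show "bdd_above (range (\<lambda>x. \<bar>pderivs is \<psi> x\<bar>))" using bd[OF that] by (auto simp: bdd_above_def)
      qed auto
      then have "0 \<le> (\<Sum>is\<in>?L. (SUP x. \<bar>pderivs is \<psi> x\<bar>))" by (rule sum_nonneg)
      moreover have "(\<Sum>is\<in>?L. (SUP x. \<bar>pderivs is \<psi> x\<bar>)) \<le> (\<Sum>is\<in>?L. \<epsilon>)"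
        by (intro sum_mono cSUP_least bd) auto
      ultimately show ?thesis
        by (meson abs_ge_self abs_ge_zero mult_left_mono mult_right_mono order_trans)
    qed
    moreover have "\<bar>C\<bar> * (\<Sum>is\<in>?L. \<epsilon>) < e"
    proof -
      have "\<bar>C\<bar> * (\<Sum>is\<in>?L. \<epsilon>) = (\<bar>C\<bar> * real (card ?L)) * \<epsilon>" by simp
      also have "\<dots> < (\<bar>C\<bar> * real (card ?L) + 1) * \<epsilon>" using eps by (intro mult_strict_right_mono) auto
      also have "\<dots> = e" using pos by (simp add: \<epsilon>_def)
      finally show ?thesis .
    qed
    ultimately show ?case by (simp add: dist_real_def)
  qed
qed

text \<open>Each partial derivative of \<open>\<kappa>\<close> is uniformly continuous, so
  translates of \<open>\<kappa>\<close> converge uniformly together with all derivatives.\<close>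

lemma distribution_translate_continuous:
  fixes f :: "(real^'n \<Rightarrow> real) \<Rightarrow> real"
  assumes f: "distribution f" and \<kappa>: "test_fun \<kappa>"
  shows "continuous_on UNIV (\<lambda>y. f (\<lambda>x. \<kappa> (x - y)))"
proof -
  obtain R where R: "R > 0" "\<And>x. norm x > R \<Longrightarrow> \<kappa> x = 0" using test_fun_radius[OF \<kappa>] by metis
  have "((\<lambda>z. f (\<lambda>x. \<kappa> (x - z))) \<longlongrightarrow> f (\<lambda>x. \<kappa> (x - y))) (at y)" for y
  proof (rule distribution_tendsto[OF f])
    show "test_fun (\<lambda>x. \<kappa> (x - z))" for z using test_fun_translate[OF \<kappa>] .
    \<comment> \<open>One radius for all translates by \<open>z\<close> with
      \<open>dist z y < 1\<close>.\<close>
    show "\<kappa> (x - y) = 0" if "norm x > R + norm y + 1" for x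
      using R(2)[of "x - y"] that norm_triangle_ineq2[of x y] by auto
    have "\<forall>\<^sub>F z in at y. dist z y < 1" by (auto simp: eventually_at intro!: exI[of _ 1])
    then show "\<forall>\<^sub>F z in at y. \<forall>x. norm x > R + norm y + 1 \<longrightarrow> \<kappa> (x - z) = 0"
    proof eventually_elim
      case (elim z)
      then have "norm z < norm y + 1" using norm_triangle_ineq2[of z y] by (simp add: dist_norm)
      then show ?case
      proof (intro allI impI)
        fix x :: "real^'n" assume "norm x > R + norm y + 1"
        then show "\<kappa> (x - z) = 0"
          using \<open>norm z < norm y + 1\<close> norm_triangle_ineq2[of x z] by (intro R(2)) linarith
      qed
    qed
    fix "is" and e :: real assume "e > 0"
    have "pderivs is \<kappa> x = 0" if "norm x > R" for x
      using pderivs_vanish[of R \<kappa>] R(2) that by blast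
    then obtain d where d: "d > 0" "\<And>x y. dist x y < d \<Longrightarrow> \<bar>pderivs is \<kappa> x - pderivs is \<kappa> y\<bar> < e"
      using compact_support_uniformly_continuous[OF smooth_fun_continuous[OF test_fun_smooth[OF \<kappa>]] _ \<open>e > 0\<close>, of R "is"]
      by metis
    have "\<forall>\<^sub>F z in at y. dist z y < d" using d(1) by (auto simp: eventually_at)
    then show "\<forall>\<^sub>F z in at y. \<forall>x. \<bar>pderivs is (\<lambda>x. \<kappa> (x - z)) x - pderivs is (\<lambda>x. \<kappa> (x - y)) x\<bar> \<le> e"
    proof eventually_elim
      case (elim z)
      have "dist (x - z) (x - y) < d" for x
        using elim by (simp add: dist_norm norm_minus_commute)
      then show ?case
        unfolding pderivs_translate[OF \<kappa>] using d(2) less_imp_le by blast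
    qed
  qed (rule test_fun_translate[OF \<kappa>])
  then show ?thesis by (simp add: continuous_on_def)
qed

text \<open>The convolution is a limit of Riemann sums, which are finite combinations of translates
  of \<open>\<kappa>\<close>. They converge uniformly with all derivatives, so \<open>f\<close> may
  be applied term by term, and the scalar Riemann sums identify the limit.\<close>

lemma distribution_conv:
  fixes f :: "(real^'n \<Rightarrow> real) \<Rightarrow> real"
  assumes f: "distribution f" and psi: "continuous_on UNIV \<psi>" "\<And>y. norm y > R \<Longrightarrow> \<psi> y = 0"
    and \<kappa>: "test_fun \<kappa>"
  shows "f (conv \<psi> \<kappa>) = integral UNIV (\<lambda>y. \<psi> y * f (\<lambda>x. \<kappa> (x - y)))"
proof -
  obtain S where S: "S > 0" "\<And>x. norm x > S \<Longrightarrow> \<kappa> x = 0" using test_fun_radius[OF \<kappa>] by metis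
  define Q where "Q = max R 0"
  have psiQ: "\<psi> y = 0" if "norm y > Q" for y using that psi(2) by (simp add: Q_def)
  obtain a :: "real^'n" where a: "cball 0 R \<subseteq> cbox (-a) a"
    using bounded_subset_cbox_symmetric[OF bounded_cball] by metis
  let ?K = "cbox (-a) a"
  have 0: "\<psi> y = 0" if "y \<notin> ?K" for y
    using a that psi(2)[of y] by (force simp: not_le)
  define L where "L y = f (\<lambda>x. \<kappa> (x - y))" for y
  have L_cont: "continuous_on UNIV L"
    unfolding L_def[abs_def] by (rule distribution_translate_continuous[OF f \<kappa>])
  have "\<exists>p. p tagged_division_of ?K \<and> (\<lambda>t. ball t (1 / real (Suc n))) fine p" for n
    using fine_division_exists[OF gauge_ball, of "1 / real (Suc n)" "-a" a]
    by (metis divide_pos_pos of_nat_0_less_iff zero_less_Suc zero_less_one)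
  then obtain p where p: "\<And>n. p n tagged_division_of ?K" "\<And>n. (\<lambda>t. ball t (1 / real (Suc n))) fine p n"
    by metis
  \<comment> \<open>Uniform over a family \<open>g\<close>: the index is the point \<open>x\<close>
    for the derivatives of the convolution, and a dummy of type \<open>unit\<close> for the scalar
    integral.\<close>
  have riemann: "\<forall>\<^sub>F n in sequentially. \<forall>i. \<bar>(\<Sum>z\<in>p n. measure lborel (snd z) * g i (fst z)) - integral ?K (g i)\<bar> \<le> e"
    if g: "\<And>i. continuous_on ?K (g i)" and e: "e > 0"
      and osc: "\<And>e. e > 0 \<Longrightarrow> \<exists>\<delta>>0. \<forall>i. \<forall>s\<in>?K. \<forall>t\<in>?K. dist t s < \<delta> \<longrightarrow> \<bar>g i t - g i s\<bar> \<le> e"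
    for g :: "'i \<Rightarrow> real^'n \<Rightarrow> real" and e
  proof -
    define \<epsilon> where "\<epsilon> = e / (measure lborel ?K + 1)"
    have c: "measure lborel ?K + 1 > 0" by (simp add: add_nonneg_pos)
    have eps: "\<epsilon> > 0" using c e by (simp add: \<epsilon>_def)
    from osc[OF this] obtain \<delta> where \<delta>: "\<delta> > 0"
      "\<And>i s t. s \<in> ?K \<Longrightarrow> t \<in> ?K \<Longrightarrow> dist t s < \<delta> \<Longrightarrow> \<bar>g i t - g i s\<bar> \<le> \<epsilon>" by blast
    have "\<forall>\<^sub>F n in sequentially. 1 / real (Suc n) < \<delta>"
      using order_tendstoD(2)[OF LIMSEQ_inverse_real_of_nat \<delta>(1)] by (simp add: inverse_eq_divide)
    then show ?thesis
    proof eventually_elim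
      case (elim n)
      have "\<bar>(\<Sum>z\<in>p n. measure lborel (snd z) * g i (fst z)) - integral ?K (g i)\<bar> \<le> \<epsilon> * measure lborel ?K" for i
        by (rule riemann_sum_bound[OF g p(1) p(2)]) (use elim \<delta>(2) eps in auto)
      moreover have "\<epsilon> * measure lborel ?K \<le> e"
      proof -
        have "\<epsilon> * measure lborel ?K \<le> \<epsilon> * (measure lborel ?K + 1)" using eps by simp
        then show ?thesis using c by (simp add: \<epsilon>_def)
      qed
      ultimately show ?case by (meson order_trans)
    qed
  qed
  define \<Phi> where "\<Phi> n x = (\<Sum>z\<in>p n. (measure lborel (snd z) * \<psi> (fst z)) * \<kappa> (x - fst z))" for n x
  have "(\<lambda>n. f (\<Phi> n)) \<longlonglongrightarrow> f (conv \<psi> \<kappa>)"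
  proof (rule distribution_tendsto[OF f])
    show "test_fun (\<Phi> n)" for n
      unfolding \<Phi>_def[abs_def] by (rule test_fun_translates) (rule \<kappa>)
    show cv0: "conv \<psi> \<kappa> x = 0" if "norm x > Q + S" for x
      using conv_vanish[OF psiQ S(2) that] .
    show "test_fun (conv \<psi> \<kappa>)"
      using smooth_fun_conv(1)[OF psi test_fun_smooth[OF \<kappa>]] cv0 by (auto simp: test_fun_iff)
    show "\<forall>\<^sub>F n in sequentially. \<forall>x. norm x > Q + S \<longrightarrow> \<Phi> n x = 0"
    proof (intro always_eventually allI impI)
      fix n and x :: "real^'n" assume x: "norm x > Q + S"
      have "\<psi> t * \<kappa> (x - t) = 0" for t
        using psiQ[of t] S(2)[of "x - t"] x norm_triangle_ineq2[of x t]
        by (cases "norm t > Q") auto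
      then show "\<Phi> n x = 0" unfolding \<Phi>_def by (intro sum.neutral) (simp add: mult.assoc)
    qed
    fix "is" and e :: real assume e: "e > 0"
    define \<eta> where "\<eta> = pderivs is \<kappa>"
    have eta: "continuous_on UNIV \<eta>" "\<And>x. norm x > S \<Longrightarrow> \<eta> x = 0"
      unfolding \<eta>_def using smooth_fun_continuous[OF test_fun_smooth[OF \<kappa>]]
        pderivs_vanish[of S \<kappa>, OF S(2)] by simp_all
    obtain M1 where M1: "M1 > 0" "\<And>x. \<bar>\<psi> x\<bar> \<le> M1" using compact_support_bounded[OF psi] by metis
    obtain M2 where M2: "M2 > 0" "\<And>x. \<bar>\<eta> x\<bar> \<le> M2" using compact_support_bounded[OF eta] by metis
    define g where "g x t = \<psi> t * \<eta> (x - t)" for x t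
    have "\<forall>\<^sub>F n in sequentially. \<forall>x. \<bar>(\<Sum>z\<in>p n. measure lborel (snd z) * g x (fst z)) - integral ?K (g x)\<bar> \<le> e"
    proof (rule riemann[OF _ e])
      show "continuous_on ?K (g x)" for x
        unfolding g_def[abs_def]
        by (intro continuous_intros continuous_on_compose2[OF psi(1)] continuous_on_compose2[OF eta(1)]) auto
      fix e :: real assume e: "e > 0"
      have e1: "e / (2 * M2) > 0" and e2: "e / (2 * M1) > 0" using e M1 M2 by auto
      obtain d1 where d1: "d1 > 0" "\<And>x y. dist x y < d1 \<Longrightarrow> \<bar>\<psi> x - \<psi> y\<bar> < e / (2 * M2)"
        using compact_support_uniformly_continuous[OF psi e1] by metis
      obtain d2 where d2: "d2 > 0" "\<And>x y. dist x y < d2 \<Longrightarrow> \<bar>\<eta> x - \<eta> y\<bar> < e / (2 * M1)"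
        using compact_support_uniformly_continuous[OF eta e2] by metis
      \<comment> \<open>Moving \<open>x\<close> does not change the distance between
        \<open>x - t\<close> and \<open>x - s\<close>, so one radius serves every
        \<open>x\<close>.\<close>
      have "\<bar>g x t - g x s\<bar> \<le> e" if "dist t s < min d1 d2" for x s t
      proof -
        have "g x t - g x s = (\<psi> t - \<psi> s) * \<eta> (x - t) + \<psi> s * (\<eta> (x - t) - \<eta> (x - s))"
          by (simp add: g_def algebra_simps)
        then have "\<bar>g x t - g x s\<bar> \<le> \<bar>\<psi> t - \<psi> s\<bar> * \<bar>\<eta> (x - t)\<bar> + \<bar>\<psi> s\<bar> * \<bar>\<eta> (x - t) - \<eta> (x - s)\<bar>"
          using abs_triangle_ineq by (simp add: abs_mult[symmetric])
        also have "\<dots> \<le> e / (2 * M2) * M2 + M1 * (e / (2 * M1))"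
        proof (intro add_mono mult_mono)
          show "\<bar>\<psi> t - \<psi> s\<bar> \<le> e / (2 * M2)" using d1(2)[of t s] that by simp
          have "dist (x - t) (x - s) < d2" using that by (simp add: dist_norm norm_minus_commute)
          then show "\<bar>\<eta> (x - t) - \<eta> (x - s)\<bar> \<le> e / (2 * M1)" using d2(2) less_imp_le by blast
        qed (use M1 M2 e in auto)
        also have "\<dots> = e" using M1 M2 by simp
        finally show ?thesis .
      qed
      then show "\<exists>\<delta>>0. \<forall>x. \<forall>s\<in>?K. \<forall>t\<in>?K. dist t s < \<delta> \<longrightarrow> \<bar>g x t - g x s\<bar> \<le> e"
        using d1(1) d2(1) by (intro exI[of _ "min d1 d2"]) auto
    qed
    moreover have "pderivs is (\<Phi> n) x = (\<Sum>z\<in>p n. measure lborel (snd z) * g x (fst z))" for n x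
      unfolding \<Phi>_def[abs_def]
      by (subst smooth_fun_translates(2)) (use test_fun_smooth[OF \<kappa>] in \<open>auto simp: g_def \<eta>_def mult.assoc\<close>)
    moreover have "pderivs is (conv \<psi> \<kappa>) x = integral ?K (g x)" for x
    proof -
      have "pderivs is (conv \<psi> \<kappa>) x = integral UNIV (g x)"
        using smooth_fun_conv(2)[OF psi test_fun_smooth[OF \<kappa>]]
        by (simp add: conv_def[of _ \<eta>, unfolded \<eta>_def] g_def[abs_def] \<eta>_def)
      also have "\<dots> = integral ?K (g x)"
        by (rule integral_UNIV_eq_cbox) (simp add: g_def 0)
      finally show ?thesis .
    qed
    ultimately show "\<forall>\<^sub>F n in sequentially. \<forall>x. \<bar>pderivs is (\<Phi> n) x - pderivs is (conv \<psi> \<kappa>) x\<bar> \<le> e"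
      by simp
  qed
  moreover have "f (\<Phi> n) = (\<Sum>z\<in>p n. measure lborel (snd z) * (\<psi> (fst z) * L (fst z)))" for n
    unfolding \<Phi>_def[abs_def] L_def
    by (subst distribution_sum[OF f]) (auto simp: mult.assoc test_fun_translate[OF \<kappa>])
  moreover have "(\<lambda>n. \<Sum>z\<in>p n. measure lborel (snd z) * (\<psi> (fst z) * L (fst z))) \<longlonglongrightarrow> integral ?K (\<lambda>y. \<psi> y * L y)"
  proof (rule tendstoI)
    fix e :: real assume e: "e > 0"
    have cont: "continuous_on ?K (\<lambda>y. \<psi> y * L y)"
      using psi(1) L_cont by (auto intro!: continuous_intros intro: continuous_on_subset)
    have "\<forall>\<^sub>F n in sequentially. \<forall>i::unit. \<bar>(\<Sum>z\<in>p n. measure lborel (snd z) * (\<psi> (fst z) * L (fst z)))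
        - integral ?K (\<lambda>y. \<psi> y * L y)\<bar> \<le> e / 2"
    proof (rule riemann[OF cont])
      fix e :: real assume e: "e > 0"
      from compact_uniformly_continuous[OF cont compact_cbox]
      obtain d where "d > 0" "\<And>s t. s \<in> ?K \<Longrightarrow> t \<in> ?K \<Longrightarrow> dist t s < d \<Longrightarrow> dist (\<psi> t * L t) (\<psi> s * L s) < e"
        using e unfolding uniformly_continuous_on_def by metis
      then show "\<exists>\<delta>>0. \<forall>i. \<forall>s\<in>?K. \<forall>t\<in>?K. dist t s < \<delta> \<longrightarrow> \<bar>\<psi> t * L t - \<psi> s * L s\<bar> \<le> e"
        by (intro exI[of _ d]) (auto simp: dist_real_def less_imp_le)
    qed (use e in auto)
    then show "\<forall>\<^sub>F n in sequentially. dist (\<Sum>z\<in>p n. measure lborel (snd z) * (\<psi> (fst z) * L (fst z)))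
        (integral ?K (\<lambda>y. \<psi> y * L y)) < e"
      by eventually_elim (use e in \<open>auto simp: dist_real_def\<close>)
  qed
  ultimately have "f (conv \<psi> \<kappa>) = integral ?K (\<lambda>y. \<psi> y * L y)"
    using LIMSEQ_unique by simp
  also have "\<dots> = integral UNIV (\<lambda>y. \<psi> y * L y)"
    by (rule integral_UNIV_eq_cbox[symmetric]) (simp add: 0)
  finally show ?thesis by (simp add: L_def)
qed

section \<open>Polynomiality\<close>

text \<open>A kernel \<open>\<kappa>\<close>, built from dilates of one test function \<open>\<phi>\<close>, integrates every \<open>F\<close> killed by
  \<open>N\<close>-fold differences to \<open>F 0\<close>. Applied to \<open>F y = f (\<lambda>x. \<psi> (x - y))\<close> this gives \<open>f \<psi> = f (conv \<kappa> \<psi>)\<close>,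
  and exchanging the roles of \<open>\<kappa>\<close> and \<open>\<psi>\<close> represents \<open>f\<close> by a continuous function.
  Taking \<open>\<phi>\<close> to be the square of some nonzero test function makes its integral nonzero
  without constructing a bump function; if no nonzero test function exists, nothing is to be proved.\<close>
theorem frechet_poly_distribution:
  fixes f :: "(real^'n \<Rightarrow> real) \<Rightarrow> real"
  assumes f: "distribution f"
    and van: "\<And>\<psi> v. test_fun \<psi> \<Longrightarrow> (fdiff v ^^ N) (\<lambda>y. f (\<lambda>x. \<psi> (x - y))) = (\<lambda>_. 0)"
  shows "poly_distribution f"
proof (cases "\<exists>\<phi> :: real^'n \<Rightarrow> real. test_fun \<phi> \<and> \<phi> \<noteq> (\<lambda>_. 0)")
  case False
  have "f (\<lambda>_. 0) = 0" using distribution_sum[OF f, of "{}"] by simp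
  then have "\<forall>\<phi>. test_fun \<phi> \<longrightarrow> f \<phi> = integral UNIV (\<lambda>x. 0 * \<phi> x)" using False by auto
  then show ?thesis unfolding poly_distribution_def using is_polynomial_const by blast
next
  case True
  then obtain \<phi>0 :: "real^'n \<Rightarrow> real" and z where \<phi>0: "test_fun \<phi>0" "\<phi>0 z \<noteq> 0" by fastforce
  define \<phi> where "\<phi> x = \<phi>0 x * \<phi>0 x" for x
  have phi: "test_fun \<phi>" unfolding \<phi>_def[abs_def] by (rule test_fun_mult[OF \<phi>0(1) \<phi>0(1)])
  obtain R where R: "R > 0" "\<And>x. norm x > R \<Longrightarrow> \<phi> x = 0" using test_fun_radius[OF phi] by metis
  have phi_cont: "continuous_on UNIV \<phi>"
    using smooth_fun_continuous_self[OF test_fun_smooth[OF phi]] .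
  define m where "m = integral UNIV \<phi>"
  have phi_int: "\<phi> integrable_on UNIV"
    using has_integral_UNIV_compact_support[OF phi_cont, of R] R(2) by blast
  have "m \<noteq> 0"
  proof
    assume "m = 0"
    have "\<phi> z > 0" using \<phi>0(2) by (auto simp: \<phi>_def zero_less_mult_iff linorder_neq_iff)
    obtain a :: "real^'n" where a: "cball 0 (norm z + 1) \<subseteq> cbox (-a) a"
      using bounded_subset_cbox_symmetric[OF bounded_cball] by metis
    have "ball z 1 \<subseteq> cbox (-a) a"
    proof
      fix x assume "x \<in> ball z 1"
      then have "norm x \<le> norm z + 1" using norm_triangle_ineq2[of x z] by (simp add: dist_norm norm_minus_commute)
      then show "x \<in> cbox (-a) a" using a by auto
    qed
    then have "z \<in> box (-a) a" using interior_maximal[OF _ open_ball] by (metis centre_in_ball interior_cbox subset_eq zero_less_one)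
    then have ne: "box (-a) a \<noteq> {}" "z \<in> cbox (-a) a" using box_subset_cbox by blast+
    have c: "continuous_on (cbox (-a) a) \<phi>" using phi_cont continuous_on_subset by blast
    have "integral (cbox (-a) a) \<phi> \<le> integral UNIV \<phi>"
      using integrable_continuous[OF c] phi_int by (intro integral_subset_le) (auto simp: \<phi>_def)
    moreover have "integral (cbox (-a) a) \<phi> \<ge> 0"
      using integrable_continuous[OF c] by (rule integral_nonneg) (simp add: \<phi>_def)
    ultimately have "integral (cbox (-a) a) \<phi> = 0" using \<open>m = 0\<close> by (simp add: m_def)
    then show False
      using integral_cbox_eq_0_iff[OF c ne(1)] ne(2) \<open>\<phi> z > 0\<close> by (force simp: \<phi>_def)
  qed
  obtain w where w0: "w 0 \<noteq> (0::real)" and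
    w: "\<And>(F :: real^'n \<Rightarrow> real) v x. (fdiff v ^^ N) F x = (\<Sum>k\<le>N. w k * F (x + real k *\<^sub>R v))"
    using fdiff_funpow_weights by blast
  \<comment> \<open>Multiply the vanishing difference at 0 with step \<open>y\<close> by
    \<open>\<phi> y\<close> and integrate over \<open>y\<close>: the term of index \<open>k\<close>
    becomes an integral against the dilate \<open>\<phi>k k\<close>, with Jacobian
    \<open>real k ^ CARD('n)\<close>, and the equation is solved for \<open>F 0\<close>.\<close>
  define c where "c k = - w k / (w 0 * m * real k ^ CARD('n))" for k
  define \<phi>k where "\<phi>k k x = \<phi> ((1 / real k) *\<^sub>R x)" for k x
  define \<kappa> where "\<kappa> x = (\<Sum>k\<in>{1..N}. c k * \<phi>k k x)" for x
  have phik: "test_fun (\<phi>k k)" if "k \<in> {1..N}" for k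
  proof -
    have "matrix (\<lambda>x::real^'n. real k *\<^sub>R x) ** matrix (\<lambda>x. (1 / real k) *\<^sub>R x) = mat 1"
      using that by (subst matrix_compose[symmetric]) (auto simp: o_def linear_iff algebra_simps matrix_id_mat_1[unfolded id_def])
    from test_fun_matrix[OF phi this]
    show ?thesis
      unfolding \<phi>k_def[abs_def] by (simp add: matrix_works linear_iff algebra_simps)
  qed
  have kappa: "test_fun \<kappa>"
    unfolding \<kappa>_def[abs_def] by (rule test_fun_sum) (rule phik)
  obtain S where S: "S > 0" "\<And>x. norm x > S \<Longrightarrow> \<kappa> x = 0" using test_fun_radius[OF kappa] by metis
  define p where "p y = f (\<lambda>x. \<kappa> (x - y))" for y
  have "is_polynomial p"
    unfolding p_def[abs_def]
    by (rule frechet_polynomial[OF distribution_translate_continuous[OF f kappa] van[OF kappa]])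
  moreover have "f \<psi> = integral UNIV (\<lambda>x. p x * \<psi> x)" if psi: "test_fun \<psi>" for \<psi>
  proof -
    define F where "F y = f (\<lambda>x. \<psi> (x - y))" for y
    have F_cont: "continuous_on UNIV F"
      unfolding F_def[abs_def] by (rule distribution_translate_continuous[OF f psi])
    obtain Q where Q: "Q > 0" "\<And>x. norm x > Q \<Longrightarrow> \<psi> x = 0" using test_fun_radius[OF psi] by metis
    have kcont: "continuous_on UNIV \<kappa>" "continuous_on UNIV \<psi>"
      using smooth_fun_continuous_self test_fun_smooth kappa psi by blast+
    \<comment> \<open>The same value \<open>F 0\<close> is obtained for every step \<open>y\<close>,
      which is what makes averaging over \<open>y\<close> possible.\<close>
    have F0: "w 0 * F 0 = - (\<Sum>k\<in>{1..N}. w k * F (real k *\<^sub>R y))" for y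
    proof -
      have "0 = (\<Sum>k\<le>N. w k * F (real k *\<^sub>R y))"
        using w[where F = F and v = y and x = 0] fun_cong[OF van[OF psi]] by (simp add: F_def[abs_def])
      also have "\<dots> = w 0 * F 0 + (\<Sum>k\<in>{1..N}. w k * F (real k *\<^sub>R y))"
        by (simp add: atMost_atLeast0 sum.atLeast_Suc_atMost)
      finally show ?thesis by simp
    qed
    have scaled: "integral UNIV (\<lambda>y. \<phi>k k y * F y) = real k ^ CARD('n) * integral UNIV (\<lambda>y. \<phi> y * F (real k *\<^sub>R y))"
      and scaled_int: "(\<lambda>y. \<phi> y * F (real k *\<^sub>R y)) integrable_on UNIV"
      if k: "k \<in> {1..N}" for k
    proof -
      have cont: "continuous_on UNIV (\<lambda>y. \<phi> y * F (real k *\<^sub>R y))"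
        by (intro continuous_intros phi_cont continuous_on_compose2[OF F_cont]) auto
      have zero: "\<phi> y * F (real k *\<^sub>R y) = 0" if "norm y > R" for y using R(2)[OF that] by simp
      show "(\<lambda>y. \<phi> y * F (real k *\<^sub>R y)) integrable_on UNIV"
        using has_integral_UNIV_compact_support[OF cont zero] by (auto simp: integrable_on_def)
      show "integral UNIV (\<lambda>y. \<phi>k k y * F y) = real k ^ CARD('n) * integral UNIV (\<lambda>y. \<phi> y * F (real k *\<^sub>R y))"
        using integral_UNIV_affine[OF cont, of R "1 / real k" 0] zero k
        by (simp add: \<phi>k_def power_one_over divide_simps)
    qed
    have int_k: "(\<lambda>y. \<phi>k k y * F y) integrable_on UNIV" if k: "k \<in> {1..N}" for k
    proof -
      obtain T where T: "\<And>x. norm x > T \<Longrightarrow> \<phi>k k x = 0" using test_fun_radius[OF phik[OF k]] by metis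
      have "continuous_on UNIV (\<lambda>y. \<phi>k k y * F y)"
        using smooth_fun_continuous_self[OF test_fun_smooth[OF phik[OF k]]] F_cont by (intro continuous_on_mult)
      from has_integral_UNIV_compact_support[OF this, of T] T show ?thesis by (auto simp: integrable_on_def)
    qed
    have expand: "\<phi> y * (w 0 * F 0) = (\<Sum>k\<in>{1..N}. - w k * (\<phi> y * F (real k *\<^sub>R y)))" for y
      unfolding F0[of y] by (simp add: sum_distrib_left sum_negf mult_ac)
    have "w 0 * F 0 * m = integral UNIV (\<lambda>y. \<phi> y * (w 0 * F 0))"
      by (simp add: m_def)
    also have "\<dots> = integral UNIV (\<lambda>y. \<Sum>k\<in>{1..N}. - w k * (\<phi> y * F (real k *\<^sub>R y)))"
      by (simp only: expand)
    also have "\<dots> = (\<Sum>k\<in>{1..N}. - w k * integral UNIV (\<lambda>y. \<phi> y * F (real k *\<^sub>R y)))"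
      by (subst integral_sum) (auto intro!: integrable_on_mult_right integrable_neg scaled_int)
    finally have "F 0 = (\<Sum>k\<in>{1..N}. - w k * integral UNIV (\<lambda>y. \<phi> y * F (real k *\<^sub>R y))) / (w 0 * m)"
      using w0 \<open>m \<noteq> 0\<close> by (simp add: field_simps)
    also have "\<dots> = (\<Sum>k\<in>{1..N}. c k * integral UNIV (\<lambda>y. \<phi>k k y * F y))"
      unfolding sum_divide_distrib by (rule sum.cong) (auto simp: c_def scaled)
    also have "\<dots> = integral UNIV (\<lambda>y. \<Sum>k\<in>{1..N}. c k * (\<phi>k k y * F y))"
      by (subst integral_sum) (auto intro!: integrable_on_mult_right int_k)
    also have "\<dots> = integral UNIV (\<lambda>y. \<kappa> y * F y)"
      by (simp add: \<kappa>_def sum_distrib_right mult.assoc)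
    also have "\<dots> = f (conv \<kappa> \<psi>)"
      unfolding F_def using distribution_conv[OF f kcont(1) S(2) psi] by simp
    also have "\<dots> = f (conv \<psi> \<kappa>)"
      by (simp only: conv_commute[OF kcont(1) S(2) kcont(2)])
    also have "\<dots> = integral UNIV (\<lambda>y. \<psi> y * p y)"
      unfolding p_def using distribution_conv[OF f kcont(2) Q(2) kappa] by simp
    finally show ?thesis by (simp add: F_def mult.commute)
  qed
  ultimately show ?thesis unfolding poly_distribution_def by blast
qed

section \<open>Continuous functions and distributions as instances\<close>

lemma invariant_continuous_polynomial:
  fixes G :: "(real^'n^'n) set" and z0 :: "real^'n" and V :: "(real^'n \<Rightarrow> real) set"
  assumes G: "subgroup_GL G" and int: "interior (Lambda_set G z0) \<noteq> {}"
    and cont: "V \<subseteq> {g. continuous_on UNIV g}" and fin: "fin_dim_subspace V"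
    and tau: "\<forall>h. tau_C h ` V \<subseteq> V" and O: "\<forall>P\<in>G. O_C P ` V \<subseteq> V" and g: "g \<in> V"
  shows "is_polynomial g"
proof -
  have "\<exists>N. \<forall>g\<in>V. \<forall>a v. (fdiff v ^^ N) (\<lambda>y. tau_C y g a) = (\<lambda>_. 0)"
  proof (rule translations_unipotent[OF G int fin])
    show "tau_C h g \<in> V" if "g \<in> V" for h g using tau that by blast
    show "O_C P g \<in> V" if "P \<in> G" "g \<in> V" for P g using O that by blast
    show "tau_C h (tau_C k g) = tau_C (h + k) g" for h k and g :: "real^'n \<Rightarrow> real"
      by (simp add: tau_C_def add_ac)
    show "O_C P (tau_C (P *v h) g) = tau_C h (O_C P g)" for P h and g :: "real^'n \<Rightarrow> real"
      by (simp add: tau_C_def O_C_def matrix_vector_right_distrib)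
    show "O_C (matrix_inv P) (O_C P g) = g" if "P \<in> G" for P g
      using subgroup_GL_inverse[OF G that] by (simp add: O_C_def matrix_vector_mul_assoc)
  qed (auto simp: linear_op_def tau_C_def O_C_def)
  \<comment> \<open>Evaluating the orbit function at the point 0 gives back
    \<open>g\<close>.\<close>
  then obtain N where N: "\<And>v. (fdiff v ^^ N) (\<lambda>y. tau_C y g 0) = (\<lambda>_. 0)" using g by blast
  have "continuous_on UNIV g" using cont g by auto
  then show ?thesis
    by (rule frechet_polynomial[where N = N]) (use N in \<open>simp add: tau_C_def\<close>)
qed

text \<open>Here the elements of \<open>V\<close> are functions on test functions, and the orbit
  function at \<open>\<psi>\<close> is \<open>y \<mapsto> f (\<lambda>x. \<psi> (x - y))\<close>, to
  which \<open>frechet_poly_distribution\<close> applies.\<close>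

lemma invariant_distribution_polynomial:
  fixes G :: "(real^'n^'n) set" and z0 :: "real^'n" and V :: "((real^'n \<Rightarrow> real) \<Rightarrow> real) set"
  assumes G: "subgroup_GL G" and int: "interior (Lambda_set G z0) \<noteq> {}"
    and dist: "V \<subseteq> {f. distribution f}" and fin: "fin_dim_subspace V"
    and tau: "\<forall>h. tau_D h ` V \<subseteq> V" and O: "\<forall>P\<in>G. O_D P ` V \<subseteq> V" and f: "f \<in> V"
  shows "poly_distribution f"
proof -
  have "\<exists>N. \<forall>f\<in>V. \<forall>\<psi> v. (fdiff v ^^ N) (\<lambda>y. tau_D y f \<psi>) = (\<lambda>_. 0)"
  proof (rule translations_unipotent[OF G int fin])
    show "tau_D h f \<in> V" if "f \<in> V" for h f using tau that by blast
    show "O_D P f \<in> V" if "P \<in> G" "f \<in> V" for P f using O that by blast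
    show "tau_D h (tau_D k f) = tau_D (h + k) f" for h k and f :: "(real^'n \<Rightarrow> real) \<Rightarrow> real"
      by (auto simp: tau_D_def fun_eq_iff test_fun_translate algebra_simps)
    have test_inv: "test_fun (\<lambda>x. \<phi> (matrix_inv P *v x))" if "test_fun \<phi>" "P \<in> G" for \<phi> P
      using test_fun_matrix[OF that(1)] subgroup_GL_inverse(2)[OF G that(2)] .
    show "O_D P (tau_D (P *v h) f) = tau_D h (O_D P f)" if P: "P \<in> G" for P h f
    proof
      fix \<phi>
      have "matrix_inv P *v (x - P *v h) = matrix_inv P *v x - h" for x
        using subgroup_GL_inverse(3)[OF G P]
        by (simp add: matrix_vector_mult_diff_distrib matrix_vector_mul_assoc)
      then show "O_D P (tau_D (P *v h) f) \<phi> = tau_D h (O_D P f) \<phi>"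
        by (simp add: O_D_def tau_D_def test_inv[OF _ P] test_fun_translate)
    qed
    show "O_D (matrix_inv P) (O_D P f) = f" if P: "P \<in> G" and f: "f \<in> V" for P f
    proof
      fix \<phi>
      note inv = subgroup_GL_inverse[OF G P]
      have "det P * det (matrix_inv P) = 1"
        using inv(2) by (metis det_I det_mul)
      then have "\<bar>det P\<bar> * \<bar>det (matrix_inv P)\<bar> = 1" by (metis abs_mult abs_one)
      \<comment> \<open>Off the test functions \<open>O_D\<close> returns 0, so the identity rests
        on the convention that distributions vanish there.\<close>
      moreover have "f \<phi> = 0" if "\<not> test_fun \<phi>" using dist f that by (auto simp: distribution_def)
      moreover have "test_fun (\<lambda>x. \<phi> (P *v x))" if "test_fun \<phi>"
        using test_fun_matrix[OF that inv(3)] .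
      ultimately show "O_D (matrix_inv P) (O_D P f) \<phi> = f \<phi>"
        by (simp add: O_D_def inv matrix_vector_mul_assoc)
    qed
  qed (auto simp: linear_op_def tau_D_def O_D_def fun_eq_iff add_divide_distrib)
  then obtain N where N: "\<And>\<psi> v. (fdiff v ^^ N) (\<lambda>y. tau_D y f \<psi>) = (\<lambda>_. 0)" using f by blast
  have "distribution f" using dist f by auto
  then show ?thesis
  proof (rule frechet_poly_distribution[where N = N])
    show "(fdiff v ^^ N) (\<lambda>y. f (\<lambda>x. \<psi> (x - y))) = (\<lambda>_. 0)" if "test_fun \<psi>" for \<psi> v
      using N[of v \<psi>] that by (simp add: tau_D_def)
  qed
qed

theorem mainTheorem2:
  fixes G :: "(real^'n^'n) set" and z0 :: "real^'n"
  assumes "subgroup_GL G"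
    and "interior (Lambda_set G z0) \<noteq> {}"
  shows "(\<forall>V :: (real^'n \<Rightarrow> real) set.
            V \<subseteq> {g. continuous_on UNIV g} \<and> fin_dim_subspace V \<and>
            (\<forall>h. tau_C h ` V \<subseteq> V) \<and> (\<forall>P\<in>G. O_C P ` V \<subseteq> V)
            \<longrightarrow> (\<forall>g\<in>V. is_polynomial g))
       \<and> (\<forall>V :: ((real^'n \<Rightarrow> real) \<Rightarrow> real) set.
            V \<subseteq> {f. distribution f} \<and> fin_dim_subspace V \<and>
            (\<forall>h. tau_D h ` V \<subseteq> V) \<and> (\<forall>P\<in>G. O_D P ` V \<subseteq> V)
            \<longrightarrow> (\<forall>f\<in>V. poly_distribution f))"
  using invariant_continuous_polynomial[OF assms] invariant_distribution_polynomial[OF assms] by blast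

end
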